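(* For each $n\geq 1$, $$\max_{w\in B_n}\left\lvert D_R(\mathtt s_B(w))\right\rvert=\left\lfloor\frac n2\right\rfloor,$$ where $\mathtt s_B:B_n\to B_n$ is the type-$B$ stack-sorting map and $D_R$ denotes the right descent set in $B_n$.
   Context: The hyperoctahedral group $B_n$ is the subgroup of $S_{2n}$ consisting of the permutations $w$ with $w(2n+1-i)=2n+1-w(i)$ for all $i\in[2n]$. With $s_i=(i\;\,i+1)\in S_{2n}$, its simple generators are $s_i^B=s_is_{2n-i}$ for $1\le i\le n-1$ and $s_n^B=s_n$. Products are compositions of functions. For $w\in B_n$, $D_R(w)=\{s_i^B: 1\le i\le n,\ w(i)>w(i+1)\}$. The left weak order on a Coxeter group is $x\leq_L y\iff \ell(yx^{-1})=\ell(y)-\ell(x)$, with $\ell$ the Coxeter length; $(B_n,\leq_L)$ is a sublattice of $(S_{2n},\leq_L)$. Type-$B$ sylvester congruence. For $w\in B_n$ and positions $1\le i<j\le 2n$, say $i$ and $j$ are separated in $w$ if there is $k$ with $i<k<j$ such that either ($k\le n$ and $w(k)<\min\{w(i),w(j)\}$) or ($k\ge n+1$ and $w(k)>\max\{w(i),w(j)\}$). Define a partial order $\preceq_w$ on $[2n]$: distinct positions $i,j$ are incomparable if and only if they are separated, and otherwise the position with the smaller value of $w$ is below the other. (This is the partial order of the permutree of $w$ in which positions $1,\ldots,n$ emit upward walls and positions $n+1,\ldots,2n$ emit downward walls.) The type-$B$ sylvester congruence on $B_n$ is the relation $v\equiv w \iff {\preceq_v}={\preceq_w}$; it is a lattice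 congruence on $(B_n,\leq_L)$ in which $\{e\}$ is a class. Each class has a unique $\leq_L$-minimal element, and $\pi_\downarrow(w)$ denotes the minimal element of the class of $w$. The type-$B$ stack-sorting map is $\mathtt s_B(w)=w\,(\pi_\downarrow(w))^{-1}$.
   Formalization: The order on positions is the permutree order; i<j with w(i)>w(j) are also incomparable if some i<k≤n<l<j has w(k)<w(l). With single-column separation alone the claim fails (n=5, w = 3 10 6 9 4 7 2 5 1 8 gives 3 descents). *)

theory Defs
  imports "HOL-Combinatorics.Permutations"
begin

definition hyperoctahedral :: "nat \<Rightarrow> (nat \<Rightarrow> nat) set" where
  "hyperoctahedral n =
     {w. w permutes {1..2 * n} \<and> (\<forall>i\<in>{1..2 * n}. w (2 * n + 1 - i) = 2 * n + 1 - w i)}"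

definition simple_gen :: "nat \<Rightarrow> nat \<Rightarrow> nat \<Rightarrow> nat" where
  "simple_gen n i =
     (if i < n then transpose i (i + 1) \<circ> transpose (2 * n - i) (2 * n - i + 1)
      else transpose n (n + 1))"

definition coxeter_length :: "nat \<Rightarrow> (nat \<Rightarrow> nat) \<Rightarrow> nat" where
  "coxeter_length n w =
     (LEAST k. \<exists>is. length is = k \<and> set is \<subseteq> {1..n} \<and>
                  foldr (\<lambda>i u. simple_gen n i \<circ> u) is id = w)"

definition right_descents :: "nat \<Rightarrow> (nat \<Rightarrow> nat) \<Rightarrow> (nat \<Rightarrow> nat) set" where
  "right_descents n w = {simple_gen n i | i. 1 \<le> i \<and> i \<le> n \<and> w i > w (i + 1)}"

definition left_weak_le :: "nat \<Rightarrow> (nat \<Rightarrow> nat) \<Rightarrow> (nat \<Rightarrow> nat) \<Rightarrow> bool" where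
  "left_weak_le n x y \<longleftrightarrow>
     int (coxeter_length n (y \<circ> inv x)) = int (coxeter_length n y) - int (coxeter_length n x)"

text \<open>
  Plot \<open>w\<close> as the points \<open>(i, w i)\<close>. The point of column \<open>k\<close> emits a vertical wall, upwards
  if \<open>k \<le> n\<close> and downwards if \<open>k \<ge> n + 1\<close>; \<open>wall n w k\<close> is the set of heights it occupies.
\<close>

definition wall :: "nat \<Rightarrow> (nat \<Rightarrow> nat) \<Rightarrow> nat \<Rightarrow> nat set" where
  "wall n w k = (if k \<le> n then {w k<..} else {..<w k})"

text \<open>
  \<open>unobstructed\<close>: the rectangle with opposite corners \<open>(i, w i)\<close> and \<open>(j, w j)\<close>, the former lower,
  contains no part of a wall of a column strictly between \<open>i\<close> and \<open>j\<close>.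
\<close>

definition unobstructed :: "nat \<Rightarrow> (nat \<Rightarrow> nat) \<Rightarrow> (nat \<times> nat) set" where
  "unobstructed n w =
     {(i, j). i \<in> {1..2 * n} \<and> j \<in> {1..2 * n} \<and> w i < w j \<and>
              (\<forall>k. min i j < k \<and> k < max i j \<longrightarrow> wall n w k \<inter> {w i..w j} = {})}"

text \<open>
  The partial order of the permutree of \<open>w\<close>: \<open>i\<close> is below \<open>j\<close> if one can climb from the point of
  column \<open>i\<close> to the point of column \<open>j\<close> without crossing a wall. Every edge of the permutree
  (a strand staying in one strip between neighbouring walls) is an unobstructed pair, and every
  unobstructed pair is comparable, so the order is the reflexive transitive closure of
  unobstructedness.

  Its incomparable pairs are not only those having a single column between them whose wall lies
  beyond both points (\<open>separated\<close> below). When \<open>i < j\<close> and \<open>w i > w j\<close>, two walls can jointly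
  block the way: the climb from \<open>j\<close> to \<open>i\<close> must pass a column \<open>l > n\<close> above height \<open>w l\<close> and
  afterwards a column \<open>k \<le> n\<close> below height \<open>w k\<close>, which is impossible if \<open>w k < w l\<close>; for
  example positions 1 and 4 of the permutation with one-line notation 4231 (\<open>n = 2\<close>). See
  \<open>permutree_order_iff\<close>.

  Declaring comparable all pairs that are not \<open>separated\<close> would give another partial order
  for each \<open>w\<close>, and the relation of having the same such order is not a lattice
  congruence of the left weak order (already for \<open>n = 3\<close>).
\<close>

definition permutree_order :: "nat \<Rightarrow> (nat \<Rightarrow> nat) \<Rightarrow> (nat \<times> nat) set" where
  "permutree_order n w = Id_on {1..2 * n} \<union> (unobstructed n w)\<^sup>+"

definition sylvester_class :: "nat \<Rightarrow> (nat \<Rightarrow> nat) \<Rightarrow> (nat \<Rightarrow> nat) set" where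
  "sylvester_class n w = {v \<in> hyperoctahedral n. permutree_order n v = permutree_order n w}"

definition pi_down :: "nat \<Rightarrow> (nat \<Rightarrow> nat) \<Rightarrow> nat \<Rightarrow> nat" where
  "pi_down n w =
     (THE v. v \<in> sylvester_class n w \<and>
             (\<forall>u \<in> sylvester_class n w. left_weak_le n u v \<longrightarrow> u = v))"

definition stack_sort :: "nat \<Rightarrow> (nat \<Rightarrow> nat) \<Rightarrow> nat \<Rightarrow> nat" where
  "stack_sort n w = w \<circ> inv (pi_down n w)"


lemma finite_hyperoctahedral: "finite (hyperoctahedral n)"
  by (rule finite_subset[OF _ finite_permutations[of "{1..2 * n}"]])
     (auto simp: hyperoctahedral_def)

lemma id_in_hyperoctahedral: "id \<in> hyperoctahedral n"
  by (simp add: hyperoctahedral_def permutes_id)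

definition separated :: "nat \<Rightarrow> (nat \<Rightarrow> nat) \<Rightarrow> nat \<Rightarrow> nat \<Rightarrow> bool" where
  "separated n w i j \<longleftrightarrow>
     (\<exists>k. min i j < k \<and> k < max i j \<and>
          (k \<le> n \<and> w k < min (w i) (w j) \<or> k \<ge> n + 1 \<and> w k > max (w i) (w j)))"

definition doubly_blocked :: "nat \<Rightarrow> (nat \<Rightarrow> nat) \<Rightarrow> nat \<Rightarrow> nat \<Rightarrow> bool" where
  "doubly_blocked n w i j \<longleftrightarrow>
     i < j \<and> w i > w j \<and> (\<exists>k l. i < k \<and> k \<le> n \<and> n + 1 \<le> l \<and> l < j \<and> w k < w l)"

lemma unobstructedD:
  assumes "(i, j) \<in> unobstructed n w"
  shows "i \<in> {1..2 * n}" "j \<in> {1..2 * n}" "w i < w j"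
    and "\<And>k. min i j < k \<Longrightarrow> k < max i j \<Longrightarrow> k \<le> n \<Longrightarrow> w j \<le> w k"
    and "\<And>k. min i j < k \<Longrightarrow> k < max i j \<Longrightarrow> k \<ge> n + 1 \<Longrightarrow> w k \<le> w i"
proof -
  show *: "i \<in> {1..2 * n}" "j \<in> {1..2 * n}" "w i < w j"
    using assms by (auto simp: unobstructed_def)
  have W: "wall n w k \<inter> {w i..w j} = {}" if "min i j < k" "k < max i j" for k
    using assms that by (simp add: unobstructed_def)
  show "w j \<le> w k" if "min i j < k" "k < max i j" "k \<le> n" for k
  proof (rule ccontr)
    assume "\<not> w j \<le> w k"
    then have "w j \<in> wall n w k \<inter> {w i..w j}" using * that by (simp add: wall_def)
    then show False using W[OF that(1,2)] by blast
  qed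
  show "w k \<le> w i" if "min i j < k" "k < max i j" "k \<ge> n + 1" for k
  proof (rule ccontr)
    assume "\<not> w k \<le> w i"
    then have "w i \<in> wall n w k \<inter> {w i..w j}" using * that by (simp add: wall_def)
    then show False using W[OF that(1,2)] by blast
  qed
qed

lemma trancl_unobstructedD:
  assumes "(i, j) \<in> (unobstructed n w)\<^sup>+"
  shows "i \<in> {1..2 * n} \<and> j \<in> {1..2 * n} \<and> w i < w j"
  using assms by (induction rule: trancl_induct) (auto dest: unobstructedD(1-3))

lemma partial_order_permutree_order: "partial_order_on {1..2 * n} (permutree_order n w)"
proof -
  have "refl_on {1..2 * n} (permutree_order n w)"
    by (auto simp: refl_on_def permutree_order_def dest: trancl_unobstructedD)
  moreover have "permutree_order n w \<subseteq> {1..2 * n} \<times> {1..2 * n}"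
    by (auto simp: permutree_order_def dest: trancl_unobstructedD)
  moreover have "trans (permutree_order n w)"
    by (rule transI) (auto simp: permutree_order_def intro: trancl_trans)
  moreover have "antisym (permutree_order n w)"
    by (rule antisymI) (auto simp: permutree_order_def dest!: trancl_unobstructedD)
  ultimately show ?thesis
    by (simp add: partial_order_on_def preorder_on_def)
qed

lemma not_separated_iff:
  assumes "w i < w j"
  shows "\<not> separated n w i j \<and> \<not> doubly_blocked n w j i \<longleftrightarrow>
    (\<forall>k. min i j < k \<and> k < max i j \<and> k \<le> n \<longrightarrow> w i \<le> w k) \<and>
    (\<forall>l. min i j < l \<and> l < max i j \<and> n + 1 \<le> l \<longrightarrow> w l \<le> w j) \<and>
    (\<forall>k l. j < k \<and> k \<le> n \<and> n + 1 \<le> l \<and> l < i \<longrightarrow> w l \<le> w k)"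
proof -
  have "min (w i) (w j) = w i" "max (w i) (w j) = w j" using assms by simp_all
  moreover have "doubly_blocked n w j i \<longleftrightarrow>
      (\<exists>k l. j < k \<and> k \<le> n \<and> n + 1 \<le> l \<and> l < i \<and> w k < w l)"
    using assms by (force simp: doubly_blocked_def)
  ultimately show ?thesis
    unfolding separated_def by (simp only: not_le[symmetric]) blast
qed

lemma trancl_unobstructed_not_separated:
  assumes "(i, j) \<in> (unobstructed n w)\<^sup>+"
  shows "\<not> separated n w i j \<and> \<not> doubly_blocked n w j i"
  using assms
proof (induction rule: trancl_induct)
  case (base j)
  note D = unobstructedD[OF base]
  have "w l \<le> w k" if "j < k" "k \<le> n" "n + 1 \<le> l" "l < i" for k l
    using D(3) D(4)[of k] D(5)[of l] that by simp
  moreover have "w i \<le> w k" if "min i j < k" "k < max i j" "k \<le> n" for k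
    using D(3) D(4)[of k] that by simp
  moreover have "w l \<le> w j" if "min i j < l" "l < max i j" "n + 1 \<le> l" for l
    using D(3) D(5)[of l] that by simp
  ultimately show ?case
    unfolding not_separated_iff[where n = n and w = w, OF D(3)] by blast
next
  case (step j m)
  note D = unobstructedD[OF step.hyps(2)]
  have ij: "w i < w j" using trancl_unobstructedD[OF step.hyps(1)] by simp
  have im: "w i < w m" using ij D(3) by simp
  note IH = step.IH[unfolded not_separated_iff[where n = n and w = w, OF ij]]
  have up: "w i \<le> w k" if "min i j < k" "k < max i j" "k \<le> n" for k
    using IH that by blast
  have down: "w l \<le> w j" if "min i j < l" "l < max i j" "n + 1 \<le> l" for l
    using IH that by blast
  have db: "w l \<le> w k" if "j < k" "k \<le> n" "n + 1 \<le> l" "l < i" for k l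
    using IH that by blast
  have split: "(min i j < k \<and> k < max i j) \<or> k = j \<or> (min j m < k \<and> k < max j m)"
    if "min i m < k" "k < max i m" for k
    using that by (auto simp: min_def max_def split: if_splits)
  have "w i \<le> w k" if "min i m < k" "k < max i m" "k \<le> n" for k
    using split[OF that(1,2)]
  proof (elim disjE)
    assume "min j m < k \<and> k < max j m"
    then show ?thesis using D(3) D(4)[of k] that(3) ij by simp
  qed (use up that(3) ij in auto)
  moreover have "w l \<le> w m" if "min i m < l" "l < max i m" "n + 1 \<le> l" for l
    using split[OF that(1,2)]
  proof (elim disjE)
    assume "min j m < l \<and> l < max j m"
    then show ?thesis using D(3) D(5)[of l] that(3) by simp
  next
    assume "min i j < l \<and> l < max i j"
    then show ?thesis using D(3) down[of l] that(3) by simp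
  qed (use D(3) in auto)
  moreover have "w l \<le> w k" if kl: "m < k" "k \<le> n" "n + 1 \<le> l" "l < i" for k l
  proof -
    have k: "j < k \<or> w j \<le> w k"
      using D(3) D(4)[of k] kl by (cases k j rule: linorder_cases) auto
    have l: "l < j \<or> w l \<le> w j"
      using down[of l] kl by (cases l j rule: linorder_cases) auto
    have "l < j \<Longrightarrow> w l \<le> w j"
      using D(5)[of l] kl by simp
    then show ?thesis using k l db[of k l] kl by fastforce
  qed
  ultimately show ?case
    unfolding not_separated_iff[where n = n and w = w, OF im] by blast
qed

lemma not_separated_trancl_unobstructed:
  assumes "i \<in> {1..2 * n}" "j \<in> {1..2 * n}" "w i < w j" "inj_on w {1..2 * n}"
    and "\<not> separated n w i j" "\<not> doubly_blocked n w j i"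
  shows "(i, j) \<in> (unobstructed n w)\<^sup>+"
  using assms
proof (induction "max i j - min i j" arbitrary: i j rule: less_induct)
  case less
  note ij = less.prems(3)
  have free: "\<not> separated n w i j \<and> \<not> doubly_blocked n w j i"
    using less.prems(5,6) by blast
  note F = free[unfolded not_separated_iff[where n = n and w = w, OF ij]]
  have up: "w i \<le> w k" if "min i j < k" "k < max i j" "k \<le> n" for k
    using F that by blast
  have down: "w l \<le> w j" if "min i j < l" "l < max i j" "n + 1 \<le> l" for l
    using F that by blast
  have db: "w l \<le> w k" if "j < k" "k \<le> n" "n + 1 \<le> l" "l < i" for k l
    using F that by blast
  have ne: "w k \<noteq> w i" "w k \<noteq> w j" "k \<in> {1..2 * n}"
    if "min i j < k" "k < max i j" for k
  proof -
    show k: "k \<in> {1..2 * n}" using that less.prems(1,2) by auto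
    show "w k \<noteq> w i" "w k \<noteq> w j"
      using inj_onD[OF less.prems(4) _ k] less.prems(1,2) that by force+
  qed
  have via: ?case
    if k: "min i j < k" "k < max i j" and wk: "w i < w k" "w k < w j"
      and fr: "\<not> separated n w i k \<and> \<not> doubly_blocked n w k i"
        "\<not> separated n w k j \<and> \<not> doubly_blocked n w j k" for k
  proof -
    have d: "max i k - min i k < max i j - min i j" "max k j - min k j < max i j - min i j"
      using k by (auto simp: min_def max_def split: if_splits)
    have "(i, k) \<in> (unobstructed n w)\<^sup>+"
      by (rule less.hyps[OF d(1) less.prems(1) ne(3)[OF k] wk(1) less.prems(4)]) (use fr in blast)+
    moreover have "(k, j) \<in> (unobstructed n w)\<^sup>+"
      by (rule less.hyps[OF d(2) ne(3)[OF k] less.prems(2) wk(2) less.prems(4)]) (use fr in blast)+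
    ultimately show ?thesis by (rule trancl_trans)
  qed
  have sub: "min i j < m \<and> m < max i j"
    if "min i j < k" "k < max i j"
      "min i k < m \<and> m < max i k \<or> min k j < m \<and> m < max k j" for k m
    using that by (auto simp: min_def max_def split: if_splits)
  define U where "U = {k. min i j < k \<and> k < max i j \<and> k \<le> n \<and> w k < w j}"
  define L where "L = {k. min i j < k \<and> k < max i j \<and> n + 1 \<le> k \<and> w i < w k}"
  have fin: "finite U" "finite L"
    by (auto simp: U_def L_def intro: finite_subset[of _ "{..<max i j}"])
  consider "U \<noteq> {}" | "U = {}" "L \<noteq> {}" | "U = {}" "L = {}" by blast
  then show ?case
  proof cases
    case 1
    then obtain k where "k \<in> U" and kmin: "\<And>m. m \<in> U \<Longrightarrow> w k \<le> w m"
      using ex_is_arg_min_if_finite[OF fin(1), of w] by (auto simp: is_arg_min_linorder)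
    then have k: "min i j < k" "k < max i j" "k \<le> n" "w k < w j" by (auto simp: U_def)
    have ik: "w i < w k" using up[OF k(1-3)] ne(1)[OF k(1,2)] by simp
    have d: "w m \<le> w k" if "min i k < m" "m < max i k" "n + 1 \<le> m" for m
      using db[of k m] that k(1-3) by (auto simp: min_def max_def split: if_splits)
    have "\<not> separated n w i k \<and> \<not> doubly_blocked n w k i"
      unfolding not_separated_iff[where n = n and w = w, OF ik]
    proof (intro conjI allI impI)
      show "w i \<le> w m" if "min i k < m \<and> m < max i k \<and> m \<le> n" for m
        using up[of m] sub[of k m] k that by blast
      show "w m \<le> w k" if "min i k < m \<and> m < max i k \<and> n + 1 \<le> m" for m
        using d that by blast
      show "w l \<le> w m" if "k < m \<and> m \<le> n \<and> n + 1 \<le> l \<and> l < i" for m l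
        using db[of m l] that k(1-3) by (auto simp: min_def max_def split: if_splits)
    qed
    moreover have "\<not> separated n w k j \<and> \<not> doubly_blocked n w j k"
      unfolding not_separated_iff[where n = n and w = w, OF k(4)]
    proof (intro conjI allI impI)
      show "w k \<le> w m" if m: "min k j < m \<and> m < max k j \<and> m \<le> n" for m
      proof (cases "m \<in> U")
        case False
        then have "w j \<le> w m" using sub[of k m] k m by (auto simp: U_def)
        then show ?thesis using k(4) by simp
      qed (rule kmin)
      show "w m \<le> w j" if "min k j < m \<and> m < max k j \<and> n + 1 \<le> m" for m
        using down[of m] sub[of k m] k that by blast
    qed (use k(3) in linarith)
    ultimately show ?thesis using via k ik by blast
  next
    case 2
    have "Max (w ` L) \<in> w ` L" using fin(2) 2(2) by simp
    then obtain k where "k \<in> L" and kM: "w k = Max (w ` L)" by force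
    have kmax: "w m \<le> w k" if "m \<in> L" for m
      using kM fin(2) that by simp
    then have k: "min i j < k" "k < max i j" "n + 1 \<le> k" "w i < w k"
      using \<open>k \<in> L\<close> by (auto simp: L_def)
    have kj: "w k < w j" using down[OF k(1-3)] ne(2)[OF k(1,2)] by simp
    have high: "w j \<le> w m" if "min i j < m" "m < max i j" "m \<le> n" for m
      using 2(1) that by (force simp: U_def)
    have "\<not> separated n w i k \<and> \<not> doubly_blocked n w k i"
      unfolding not_separated_iff[where n = n and w = w, OF k(4)]
    proof (intro conjI allI impI)
      show "w i \<le> w m" if "min i k < m \<and> m < max i k \<and> m \<le> n" for m
        using up[of m] sub[of k m] k that by blast
      show "w m \<le> w k" if m: "min i k < m \<and> m < max i k \<and> n + 1 \<le> m" for m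
      proof (cases "m \<in> L")
        case False
        then have "w m \<le> w i" using sub[of k m] k m by (auto simp: L_def)
        then show ?thesis using k(4) by simp
      qed (rule kmax)
    qed (use k(3) in linarith)
    moreover have "\<not> separated n w k j \<and> \<not> doubly_blocked n w j k"
      unfolding not_separated_iff[where n = n and w = w, OF kj]
    proof (intro conjI allI impI)
      show "w k \<le> w m" if "min k j < m \<and> m < max k j \<and> m \<le> n" for m
        using high[of m] sub[of k m] k kj that by fastforce
      show "w m \<le> w j" if "min k j < m \<and> m < max k j \<and> n + 1 \<le> m" for m
        using down[of m] sub[of k m] k that by blast
      show "w l \<le> w m" if "j < m \<and> m \<le> n \<and> n + 1 \<le> l \<and> l < k" for m l
        using db[of m l] that k(1-3) by (auto simp: min_def max_def split: if_splits)
    qed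
    ultimately show ?thesis using via k kj by blast
  next
    case 3
    have "wall n w k \<inter> {w i..w j} = {}" if k: "min i j < k" "k < max i j" for k
    proof (cases "k \<le> n")
      case True
      then have "w j \<le> w k" using k 3(1) by (force simp: U_def)
      then show ?thesis using True by (auto simp: wall_def)
    next
      case False
      have "k \<notin> L" using 3(2) by simp
      then have "w k \<le> w i" using k False by (auto simp: L_def)
      then show ?thesis using False by (auto simp: wall_def)
    qed
    then have "(i, j) \<in> unobstructed n w"
      using less.prems(1-3) by (simp add: unobstructed_def)
    then show ?thesis by blast
  qed
qed

theorem permutree_order_iff:
  assumes "inj_on w {1..2 * n}"
  shows "(i, j) \<in> permutree_order n w \<longleftrightarrow>
    i \<in> {1..2 * n} \<and> j \<in> {1..2 * n} \<and>
    (i = j \<or> w i < w j \<and> \<not> separated n w i j \<and> \<not> doubly_blocked n w j i)"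
proof
  assume "(i, j) \<in> permutree_order n w"
  then consider "i \<in> {1..2 * n}" "i = j" | "(i, j) \<in> (unobstructed n w)\<^sup>+"
    unfolding permutree_order_def by blast
  then show "i \<in> {1..2 * n} \<and> j \<in> {1..2 * n} \<and>
    (i = j \<or> w i < w j \<and> \<not> separated n w i j \<and> \<not> doubly_blocked n w j i)"
  proof cases
    case 2
    then show ?thesis
      using trancl_unobstructed_not_separated[OF 2] trancl_unobstructedD[OF 2] by blast
  qed blast
next
  assume *: "i \<in> {1..2 * n} \<and> j \<in> {1..2 * n} \<and>
    (i = j \<or> w i < w j \<and> \<not> separated n w i j \<and> \<not> doubly_blocked n w j i)"
  show "(i, j) \<in> permutree_order n w"
  proof (cases "i = j")
    case True
    then show ?thesis using * by (simp add: permutree_order_def Id_on_iff)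
  next
    case False
    then have "(i, j) \<in> (unobstructed n w)\<^sup>+"
      using * by (intro not_separated_trancl_unobstructed[OF _ _ _ assms]) blast+
    then show ?thesis by (simp add: permutree_order_def)
  qed
qed

end

theory Submission
  imports Defs
begin

text \<open>
  The minimal element \<open>v\<close> of the class of \<open>w\<close> has only those inversions that the permutree order
  forces. So a descent of \<open>w v\<^sup>-\<^sup>1\<close> at \<open>a\<close> comes from positions \<open>p < q\<close> with \<open>v p = a\<close> and
  \<open>v q = a + 1\<close> that are separated: up to the symmetry \<open>a \<mapsto> 2n - a\<close>, there is a column
  \<open>k \<le> n\<close> between them with \<open>v k < a\<close>. If two of the columns \<open>p\<close>, \<open>k\<close> belonging to different \<open>a\<close>
  coincided, then some inversion of \<open>v\<close> would be separated by a column, contradicting minimality.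
  Hence \<open>d\<close> descents use \<open>2d\<close> different columns among \<open>1, \<dots>, n\<close>, which gives \<open>d \<le> n div 2\<close>.

  Equality holds when the columns \<open>n, n - 2, n - 4, \<dots>\<close> carry the small values \<open>1, 2, 3, \<dots>\<close>: their
  walls and the mirror images of these make all other columns pairwise incomparable, and the
  extremal \<open>w\<close> has the values of these other columns in decreasing order.
\<close>

section \<open>The group structure of B_n\<close>

lemma hyperoctahedralD:
  assumes "w \<in> hyperoctahedral n"
  shows "w permutes {1..2 * n}"
    and "1 \<le> i \<Longrightarrow> i \<le> 2 * n \<Longrightarrow> 1 \<le> w i \<and> w i \<le> 2 * n"
    and "1 \<le> i \<Longrightarrow> i \<le> 2 * n \<Longrightarrow> w (2 * n + 1 - i) = 2 * n + 1 - w i"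
    and "w i = w j \<longleftrightarrow> i = j"
    and "w (inv w i) = i" and "inv w (w i) = i"
    and "inj_on w {1..2 * n}"
proof -
  show p: "w permutes {1..2 * n}" using assms by (simp add: hyperoctahedral_def)
  show "1 \<le> i \<Longrightarrow> i \<le> 2 * n \<Longrightarrow> 1 \<le> w i \<and> w i \<le> 2 * n"
    using permutes_in_image[OF p, of i] by simp
  show "1 \<le> i \<Longrightarrow> i \<le> 2 * n \<Longrightarrow> w (2 * n + 1 - i) = 2 * n + 1 - w i"
    using assms by (simp add: hyperoctahedral_def)
  show "w i = w j \<longleftrightarrow> i = j" using permutes_inj[OF p] by (simp add: inj_eq)
  show "w (inv w i) = i" "inv w (w i) = i" using permutes_inverses[OF p] by simp_all
  show "inj_on w {1..2 * n}" using permutes_inj[OF p] by (rule inj_on_subset) simp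
qed

lemma inv_in_hyperoctahedral:
  assumes "w \<in> hyperoctahedral n"
  shows "inv w \<in> hyperoctahedral n"
proof -
  note w = hyperoctahedralD[OF assms]
  have p: "inv w permutes {1..2 * n}" using w(1) by (rule permutes_inv)
  have "inv w (2 * n + 1 - i) = 2 * n + 1 - inv w i" if "i \<in> {1..2 * n}" for i
  proof -
    have "inv w i \<in> {1..2 * n}" using permutes_in_image[OF p] that by blast
    then have "w (2 * n + 1 - inv w i) = 2 * n + 1 - i"
      using w(3)[of "inv w i"] w(5) by simp
    then show ?thesis using w(6) by metis
  qed
  then show ?thesis using p by (simp add: hyperoctahedral_def)
qed

lemma comp_in_hyperoctahedral:
  assumes "v \<in> hyperoctahedral n" "w \<in> hyperoctahedral n"
  shows "v \<circ> w \<in> hyperoctahedral n"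
  using hyperoctahedralD(1)[OF assms(1)] hyperoctahedralD(1)[OF assms(2)]
    hyperoctahedralD(2,3)[OF assms(1)] hyperoctahedralD(2,3)[OF assms(2)]
  by (auto simp: hyperoctahedral_def intro: permutes_compose)

section \<open>Coxeter length\<close>

text \<open>The condition \<open>i + j \<le> 2 * n + 1\<close> selects one pair from each orbit of the mirror symmetry.\<close>

definition inversions :: "nat \<Rightarrow> (nat \<Rightarrow> nat) \<Rightarrow> (nat \<times> nat) set" where
  "inversions n w = {(i, j). 1 \<le> i \<and> i < j \<and> i + j \<le> 2 * n + 1 \<and> w j < w i}"

lemma finite_inversions: "finite (inversions n w)"
  by (rule finite_subset[of _ "{..2 * n} \<times> {..2 * n}"]) (auto simp: inversions_def)

text \<open>Naming k through \<open>i + k = 2 * n\<close> avoids truncated subtraction and treats i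
  = n uniformly: then k = i, and the last two tests repeat the first two.\<close>

lemma simple_gen_apply:
  assumes "1 \<le> i" "i \<le> n" "i + k = 2 * n"
  shows "simple_gen n i x =
    (if x = i then i + 1 else if x = i + 1 then i
     else if x = k then k + 1 else if x = k + 1 then k else x)"
proof (cases "i < n")
  case True
  have "2 * n - i = k" using assms by simp
  moreover have "i + 1 < k" using assms True by linarith
  ultimately show ?thesis using True by (simp add: simple_gen_def transpose_def)
next
  case False
  then have "i = n" "k = n" using assms by simp_all
  then show ?thesis by (simp add: simple_gen_def transpose_def)
qed

lemma simple_gen_in_hyperoctahedral:
  assumes "1 \<le> i" "i \<le> n"
  shows "simple_gen n i \<in> hyperoctahedral n"
proof -
  have p: "simple_gen n i permutes {1..2 * n}"
    using assms
    by (auto simp: simple_gen_def intro!: permutes_compose permutes_swap_id)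
  obtain k where k: "i + k = 2 * n" using assms by (metis le_add_diff_inverse mult_2 trans_le_add1)
  \<comment> \<open>Since i + k is even, k = i + 1 is impossible: the two transpositions are equal
    or disjoint.\<close>
  then have ik: "i = k \<or> i + 1 < k" using assms by presburger
  have "simple_gen n i (2 * n + 1 - j) = 2 * n + 1 - simple_gen n i j"
    if j: "j \<in> {1..2 * n}" for j
  proof -
    define j' where "j' = 2 * n + 1 - j"
    have j': "j + j' = i + k + 1" using j k by (simp add: j'_def)
    have "simple_gen n i j + simple_gen n i j' = i + k + 1"
      unfolding simple_gen_apply[OF assms k] using ik j' by (auto split: if_splits)
    then show ?thesis using k unfolding j'_def by simp
  qed
  then show ?thesis using p by (simp add: hyperoctahedral_def)
qed

lemma simple_gen_less_iff:
  assumes "1 \<le> i" "i \<le> n" "x < y"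
  shows "simple_gen n i y < simple_gen n i x \<longleftrightarrow>
    x = i \<and> y = i + 1 \<or> x = 2 * n - i \<and> y = 2 * n + 1 - i"
proof -
  obtain k where k: "i + k = 2 * n" using assms by (metis le_add_diff_inverse mult_2 trans_le_add1)
  then have ik: "i = k \<or> i + 1 < k" using assms by presburger
  have k': "2 * n - i = k" "2 * n + 1 - i = k + 1" using k by simp_all
  show ?thesis
    unfolding simple_gen_apply[OF assms(1,2) k] k' using assms(3) ik by (cases "i = k") auto
qed

text \<open>Left multiplication acts on values, so a new inversion can only sit at the positions of
  i, i + 1 or at those of 2n - i, 2n + 1 - i. These two pairs of positions are mirror images, and
  \<open>inversions\<close> counts one of them.\<close>

lemma card_inversions_simple_gen_le:
  assumes i: "1 \<le> i" "i \<le> n" and u: "u \<in> hyperoctahedral n"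
  shows "card (inversions n (simple_gen n i \<circ> u)) \<le> card (inversions n u) + 1"
proof -
  note U = hyperoctahedralD[OF u]
  let ?D = "inversions n (simple_gen n i \<circ> u) - inversions n u"
  have new: "1 \<le> a \<and> a < b \<and> a + b \<le> 2 * n + 1 \<and>
      (u a = i \<and> u b = i + 1 \<or> u a = 2 * n - i \<and> u b = 2 * n + 1 - i)"
    if "(a, b) \<in> ?D" for a b
  proof -
    have ab: "1 \<le> a" "a < b" "a + b \<le> 2 * n + 1" "\<not> u b < u a"
      "simple_gen n i (u b) < simple_gen n i (u a)"
      using that by (auto simp: inversions_def)
    then have "u a < u b" using U(4)[of a b] by simp
    then show ?thesis using simple_gen_less_iff[OF i] ab by blast
  qed
  \<comment> \<open>Mirroring turns a coordinate sum s into 4n + 2 - s. If a pair and its mirror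
    image both have sum at most 2n + 1, both sums equal 2n + 1 and the pairs coincide.\<close>
  have cross: "a = c \<and> b = d"
    if "(a, b) \<in> ?D" "(c, d) \<in> ?D" "u a = i" "u b = i + 1" "u c = 2 * n - i" "u d = 2 * n + 1 - i"
    for a b c d
  proof -
    note N = new[OF that(1)] new[OF that(2)]
    have "u (2 * n + 1 - d) = i" "u (2 * n + 1 - c) = i + 1"
      using U(3)[of d] U(3)[of c] N that i by auto
    then have "2 * n + 1 - d = a" "2 * n + 1 - c = b" using that U(4) by metis+
    then show ?thesis using N by linarith
  qed
  have "x = y" if "x \<in> ?D" "y \<in> ?D" for x y
  proof -
    obtain a b c d where xy: "x = (a, b)" "y = (c, d)" by (cases x, cases y) blast
    have D: "(a, b) \<in> ?D" "(c, d) \<in> ?D" using that xy by simp_all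
    note N = new[OF D(1)] new[OF D(2)]
    have "a = c \<and> b = d"
    proof (cases "u a = i \<and> u b = i + 1")
      case True
      then show ?thesis using N cross[OF D] U(4) by metis
    next
      case False
      then show ?thesis using N cross[OF D(2,1)] U(4) by metis
    qed
    then show ?thesis using xy by simp
  qed
  then have "card ?D \<le> 1" by (metis card_le_Suc0_iff_eq finite_Diff finite_inversions One_nat_def)
  moreover have "card (inversions n (simple_gen n i \<circ> u)) \<le> card (inversions n u \<union> ?D)"
    by (rule card_mono) (auto simp: finite_inversions)
  ultimately show ?thesis using card_Un_le[of "inversions n u" ?D] by linarith
qed

lemma card_inversions_simple_gen_less:
  assumes i: "1 \<le> i" "i \<le> n" and u: "u \<in> hyperoctahedral n"
    and desc: "inv u (i + 1) < inv u i"
  shows "card (inversions n (simple_gen n i \<circ> u)) < card (inversions n u)"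
proof -
  note U = hyperoctahedralD[OF u]
  define p where "p = inv u i"
  define q where "q = inv u (i + 1)"
  have pq: "u p = i" "u q = i + 1" "q < p" using U(5) desc by (simp_all add: p_def q_def)
  have range: "1 \<le> q" "p \<le> 2 * n"
    using hyperoctahedralD(2)[OF inv_in_hyperoctahedral[OF u]] i by (auto simp: p_def q_def)
  have mir: "u (2 * n + 1 - p) = 2 * n + 1 - i" "u (2 * n + 1 - q) = 2 * n - i"
    using U(3)[of p] U(3)[of q] pq range i by auto
  \<comment> \<open>The lost inversion: whichever of (q, p) and its mirror image satisfies the bound
    in \<open>inversions\<close>.\<close>
  define c where "c = (if p + q \<le> 2 * n + 1 then (q, p) else (2 * n + 1 - p, 2 * n + 1 - q))"
  have "inversions n (simple_gen n i \<circ> u) \<subseteq> inversions n u"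
  proof (rule subrelI, rule ccontr)
    fix a b assume ab: "(a, b) \<in> inversions n (simple_gen n i \<circ> u)" "(a, b) \<notin> inversions n u"
    then have *: "a < b" "\<not> u b < u a" "simple_gen n i (u b) < simple_gen n i (u a)"
      by (auto simp: inversions_def)
    then have "u a < u b" using U(4)[of a b] by simp
    then have "u a = u p \<and> u b = u q \<or> u a = u (2 * n + 1 - q) \<and> u b = u (2 * n + 1 - p)"
      using simple_gen_less_iff[OF i] * mir pq by simp
    then have "a = p \<and> b = q \<or> a = 2 * n + 1 - q \<and> b = 2 * n + 1 - p" using U(4) by simp
    then show False using * pq range by linarith
  qed
  moreover have "c \<in> inversions n u"
    using pq range mir i by (auto simp: c_def inversions_def)
  moreover have "c \<notin> inversions n (simple_gen n i \<circ> u)"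
  proof -
    have "simple_gen n i i = i + 1" "simple_gen n i (i + 1) = i"
      "simple_gen n i (2 * n - i) = 2 * n + 1 - i" "simple_gen n i (2 * n + 1 - i) = 2 * n - i"
    proof -
      obtain k where k: "i + k = 2 * n" using i by (metis le_add_diff_inverse mult_2 trans_le_add1)
      then have "i = k \<or> i + 1 < k" "2 * n - i = k" "2 * n + 1 - i = k + 1" using i by presburger+
      then show "simple_gen n i i = i + 1" "simple_gen n i (i + 1) = i"
        "simple_gen n i (2 * n - i) = 2 * n + 1 - i" "simple_gen n i (2 * n + 1 - i) = 2 * n - i"
        unfolding simple_gen_apply[OF i k] by auto
    qed
    then have "\<not> simple_gen n i (u p) < simple_gen n i (u q)"
      "\<not> simple_gen n i (u (2 * n + 1 - q)) < simple_gen n i (u (2 * n + 1 - p))"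
      unfolding pq mir by simp_all
    then show ?thesis by (simp add: c_def inversions_def)
  qed
  ultimately show ?thesis by (metis psubsetI psubset_card_mono finite_inversions)
qed

lemma eq_id_if_no_descent:
  assumes "w permutes {1..m}" and "\<And>i. 1 \<le> i \<Longrightarrow> i < m \<Longrightarrow> w i < w (i + 1)"
  shows "w = (id :: nat \<Rightarrow> nat)"
proof -
  have "i \<le> w i" if "1 \<le> i" "i \<le> m" for i
    using that
  proof (induction i rule: nat_induct_at_least)
    case base
    then show ?case using permutes_in_image[OF assms(1), of 1] by simp
  next
    case (Suc i)
    then show ?case using assms(2)[of i] by simp
  qed
  then show ?thesis
    using permutes_natset_ge[OF assms(1)] by fastforce
qed

text \<open>Without such a descent \<open>inv u\<close> increases at the first n places; by the
  mirror symmetry it then increases at all places, which forces the identity.\<close>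

lemma exists_left_descent:
  assumes u: "u \<in> hyperoctahedral n" and "u \<noteq> id"
  shows "\<exists>i. 1 \<le> i \<and> i \<le> n \<and> inv u (i + 1) < inv u i"
proof (rule ccontr)
  assume no: "\<not> ?thesis"
  note V = hyperoctahedralD[OF inv_in_hyperoctahedral[OF u]]
  have low: "inv u i < inv u (i + 1)" if "1 \<le> i" "i \<le> n" for i
    using no that V(4)[of i "i + 1"] by (metis linorder_neqE_nat n_not_Suc_n Suc_eq_plus1)
  have "inv u i < inv u (i + 1)" if "1 \<le> i" "i < 2 * n" for i
  proof (cases "i \<le> n")
    case False
    have e: "2 * n + 1 - (2 * n - i) = i + 1" "2 * n + 1 - (2 * n - i + 1) = i"
      using that by simp_all
    have "inv u (i + 1) = 2 * n + 1 - inv u (2 * n - i)"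
      using V(3)[of "2 * n - i"] that e by simp
    moreover have "inv u i = 2 * n + 1 - inv u (2 * n - i + 1)"
      using V(3)[of "2 * n - i + 1"] that e by simp
    moreover have "inv u (2 * n - i) < inv u (2 * n - i + 1)"
      using low[of "2 * n - i"] that False by simp
    moreover have "inv u (2 * n - i + 1) \<le> 2 * n" using V(2)[of "2 * n - i + 1"] that False by simp
    ultimately show ?thesis by linarith
  qed (use low that in simp)
  then have "inv u = id" using V(1) by (rule eq_id_if_no_descent[rotated])
  then show False using \<open>u \<noteq> id\<close> hyperoctahedralD(5)[OF u] by fastforce
qed

lemma word_inversions_le:
  assumes "set is \<subseteq> {1..n}"
  shows "foldr (\<lambda>i u. simple_gen n i \<circ> u) is id \<in> hyperoctahedral n \<and>
    card (inversions n (foldr (\<lambda>i u. simple_gen n i \<circ> u) is id)) \<le> length is"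
  using assms
proof (induction "is")
  case Nil
  have "inversions n id = {}" by (auto simp: inversions_def)
  then have "id \<in> hyperoctahedral n \<and> card (inversions n id) \<le> length []"
    using id_in_hyperoctahedral by simp
  then show ?case by (simp add: id_def)
next
  case (Cons i "is")
  then have i: "1 \<le> i" "i \<le> n" and "set is \<subseteq> {1..n}" by auto
  note IH = Cons.IH[OF this(3)]
  have eq: "foldr (\<lambda>i u. simple_gen n i \<circ> u) (i # is) id
      = simple_gen n i \<circ> foldr (\<lambda>i u. simple_gen n i \<circ> u) is id"
    by simp
  show ?case
    unfolding eq length_Cons
  proof
    show "card (inversions n (simple_gen n i \<circ> foldr (\<lambda>i u. simple_gen n i \<circ> u) is id))
        \<le> Suc (length is)"
      using card_inversions_simple_gen_le[OF i conjunct1[OF IH]] conjunct2[OF IH] by linarith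
  qed (rule comp_in_hyperoctahedral[OF simple_gen_in_hyperoctahedral[OF i] conjunct1[OF IH]])
qed

text \<open>Sorting: multiplying by a generator at a left descent lowers the number of inversions.
  Generators are involutions, so prefixing the same letter recovers w.\<close>

lemma exists_word_inversions:
  assumes "w \<in> hyperoctahedral n"
  shows "\<exists>is. length is \<le> card (inversions n w) \<and> set is \<subseteq> {1..n} \<and>
    foldr (\<lambda>i u. simple_gen n i \<circ> u) is id = w"
  using assms
proof (induction "card (inversions n w)" arbitrary: w rule: less_induct)
  case less
  show ?case
  proof (cases "w = id")
    case True
    then show ?thesis by (intro exI[of _ "[]"]) simp
  next
    case False
    then obtain i where i: "1 \<le> i" "i \<le> n" "inv w (i + 1) < inv w i"
      using exists_left_descent[OF less.prems] by blast
    let ?s = "simple_gen n i"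
    have lt: "card (inversions n (?s \<circ> w)) < card (inversions n w)"
      using card_inversions_simple_gen_less[OF i(1,2) less.prems i(3)] .
    obtain "is" where "is": "length is \<le> card (inversions n (?s \<circ> w))" "set is \<subseteq> {1..n}"
      "foldr (\<lambda>i u. simple_gen n i \<circ> u) is id = ?s \<circ> w"
      using less.hyps[OF lt comp_in_hyperoctahedral[OF simple_gen_in_hyperoctahedral[OF i(1,2)]
          less.prems]] by blast
    obtain k where k: "i + k = 2 * n" using i by (metis le_add_diff_inverse mult_2 trans_le_add1)
    then have ik: "i = k \<or> i + 1 < k" using i by presburger
    have "?s (?s x) = x" for x
      unfolding simple_gen_apply[OF i(1,2) k] using ik by auto
    then have "?s \<circ> (?s \<circ> w) = w" by auto
    then have "foldr (\<lambda>i u. simple_gen n i \<circ> u) (i # is) id = w"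
      using "is"(3) by (simp only: foldr.simps comp_apply)
    then show ?thesis using "is"(1,2) lt i by (intro exI[of _ "i # is"]) simp
  qed
qed

lemma coxeter_length_eq:
  assumes "w \<in> hyperoctahedral n"
  shows "coxeter_length n w = card (inversions n w)"
  unfolding coxeter_length_def
proof (rule Least_equality)
  obtain "is" where "is": "length is \<le> card (inversions n w)" "set is \<subseteq> {1..n}"
    "foldr (\<lambda>i u. simple_gen n i \<circ> u) is id = w"
    using exists_word_inversions[OF assms] by blast
  then show "\<exists>is. length is = card (inversions n w) \<and> set is \<subseteq> {1..n} \<and>
      foldr (\<lambda>i u. simple_gen n i \<circ> u) is id = w"
    using word_inversions_le[OF "is"(2)] by (intro exI[of _ "is"]) simp
next
  fix k assume "\<exists>is. length is = k \<and> set is \<subseteq> {1..n} \<and>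
      foldr (\<lambda>i u. simple_gen n i \<circ> u) is id = w"
  then show "card (inversions n w) \<le> k" using word_inversions_le by blast
qed

section \<open>The left weak order through inversion sets\<close>

text \<open>Containment of the chosen orbit representatives extends to all pairs: a pair with
  coordinate sum above 2n + 1 is replaced by its mirror image.\<close>

lemma inversions_less_imp:
  assumes u: "u \<in> hyperoctahedral n" and v: "v \<in> hyperoctahedral n"
    and sub: "inversions n v \<subseteq> inversions n u"
    and ij: "1 \<le> i" "i < j" "j \<le> 2 * n" "v j < v i"
  shows "u j < u i"
proof (cases "i + j \<le> 2 * n + 1")
  case True
  then have "(i, j) \<in> inversions n v" using ij by (simp add: inversions_def)
  then show ?thesis using sub by (auto simp: inversions_def)
next
  case False
  note U = hyperoctahedralD[OF u] and V = hyperoctahedralD[OF v]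
  have "(2 * n + 1 - j, 2 * n + 1 - i) \<in> inversions n v"
    using ij False V(3)[of i] V(3)[of j] V(2)[of i] V(2)[of j] by (auto simp: inversions_def)
  then have "u (2 * n + 1 - i) < u (2 * n + 1 - j)" using sub by (auto simp: inversions_def)
  then show ?thesis using ij U(3)[of i] U(3)[of j] by simp
qed

text \<open>The inversions of \<open>u \<circ> inv v\<close> are the inversions of u that v lacks,
  with positions renamed by v. So the numbers of inversions subtract, and they are the Coxeter
  lengths.\<close>

lemma left_weak_leI:
  assumes u: "u \<in> hyperoctahedral n" and v: "v \<in> hyperoctahedral n"
    and sub: "inversions n v \<subseteq> inversions n u"
  shows "left_weak_le n v u"
proof -
  note U = hyperoctahedralD[OF u] and V = hyperoctahedralD[OF v]
  note IV = hyperoctahedralD[OF inv_in_hyperoctahedral[OF v]]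
  \<comment> \<open>Renames positions by v and, if the image has too large a coordinate sum, passes
    to its mirror image.\<close>
  define f where "f = (\<lambda>(i, j). if v i + v j \<le> 2 * n + 1 then (v i, v j)
    else (2 * n + 1 - v j, 2 * n + 1 - v i))"
  have D: "1 \<le> i \<and> i < j \<and> j \<le> 2 * n \<and> i + j \<le> 2 * n + 1 \<and> v i < v j \<and> u j < u i \<and>
      v i \<ge> 1 \<and> v j \<le> 2 * n"
    if "(i, j) \<in> inversions n u - inversions n v" for i j
    using that V(4)[of i j] V(2)[of i] V(2)[of j] by (auto simp: inversions_def)
  have flip: "a = c \<and> b = d"
    if "1 \<le> a \<and> a < b \<and> b \<le> 2 * n \<and> a + b \<le> 2 * n + 1"
      "1 \<le> c \<and> c < d \<and> d \<le> 2 * n \<and> c + d \<le> 2 * n + 1"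
      "v a = 2 * n + 1 - v d" "v b = 2 * n + 1 - v c" for a b c d
  proof -
    have "v a = v (2 * n + 1 - d)" "v b = v (2 * n + 1 - c)"
      using that V(3)[of c] V(3)[of d] by simp_all
    then have "a = 2 * n + 1 - d" "b = 2 * n + 1 - c" using V(4) by simp_all
    then show ?thesis using that by linarith
  qed
  have "bij_betw f (inversions n u - inversions n v) (inversions n (u \<circ> inv v))"
  proof (rule bij_betw_imageI)
    show "inj_on f (inversions n u - inversions n v)"
    proof (rule inj_onI)
      fix x y assume xy: "x \<in> inversions n u - inversions n v" "y \<in> inversions n u - inversions n v"
        and eq: "f x = f y"
      obtain a b c d where x: "x = (a, b)" and y: "y = (c, d)" by (cases x, cases y) blast
      note N = D[OF xy(1)[unfolded x]] D[OF xy(2)[unfolded y]]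
      have "v a = v c \<and> v b = v d \<or> v a = 2 * n + 1 - v d \<and> v b = 2 * n + 1 - v c"
        using eq N unfolding x y f_def by (simp split: if_splits) arith+
      then show "x = y"
      proof
        assume "v a = v c \<and> v b = v d"
        then show ?thesis using x y V(4) by simp
      next
        assume "v a = 2 * n + 1 - v d \<and> v b = 2 * n + 1 - v c"
        then show ?thesis using x y flip[of a b c d] N by blast
      qed
    qed
    show "f ` (inversions n u - inversions n v) = inversions n (u \<circ> inv v)"
    proof (intro equalityI subsetI)
      fix z assume "z \<in> f ` (inversions n u - inversions n v)"
      then obtain i j where ij: "(i, j) \<in> inversions n u - inversions n v" "z = f (i, j)" by auto
      note N = D[OF ij(1)]
      have m: "inv v (2 * n + 1 - v i) = 2 * n + 1 - i" "inv v (2 * n + 1 - v j) = 2 * n + 1 - j"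
        using IV(3)[of "v i"] IV(3)[of "v j"] N V(6) by simp_all
      show "z \<in> inversions n (u \<circ> inv v)"
        using N m U(3)[of i] U(3)[of j] U(2)[of i] U(2)[of j] V(6)
        by (auto simp: ij(2) f_def inversions_def intro: diff_less_mono2)
    next
      fix z assume z: "z \<in> inversions n (u \<circ> inv v)"
      obtain x y where xy: "z = (x, y)" by (cases z) blast
      define i where "i = inv v x"
      define j where "j = inv v y"
      have v_ij: "v i = x" "v j = y" using V(5) by (simp_all add: i_def j_def)
      have *: "1 \<le> x" "x < y" "x + y \<le> 2 * n + 1" "u j < u i"
        using z xy by (auto simp: inversions_def i_def j_def)
      have r: "1 \<le> i" "i \<le> 2 * n" "1 \<le> j" "j \<le> 2 * n"
        using IV(2)[of x] IV(2)[of y] * by (simp_all add: i_def j_def)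
      \<comment> \<open>Otherwise (j, i) is an inversion of v, hence one of u, against u j < u
        i.\<close>
      have "i < j"
      proof (rule ccontr)
        assume "\<not> i < j"
        then have "j < i" using * by (metis linorder_neqE_nat order.asym)
        then have "u i < u j" using inversions_less_imp[OF u v sub, of j i] r * v_ij by simp
        then show False using * by simp
      qed
      show "z \<in> f ` (inversions n u - inversions n v)"
      proof (cases "i + j \<le> 2 * n + 1")
        case True
        then have "(i, j) \<in> inversions n u - inversions n v"
          using * r v_ij \<open>i < j\<close> by (auto simp: inversions_def)
        moreover have "f (i, j) = z" using * v_ij xy by (simp add: f_def)
        ultimately show ?thesis by (metis image_eqI)
      next
        case False
        note m = U(3)[OF r(1,2)] U(3)[OF r(3,4)] V(3)[OF r(1,2)] V(3)[OF r(3,4)]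
          U(2)[OF r(1,2)] U(2)[OF r(3,4)]
        have "(2 * n + 1 - j, 2 * n + 1 - i) \<in> inversions n u - inversions n v"
        proof -
          have "u (2 * n + 1 - i) < u (2 * n + 1 - j)" "\<not> v (2 * n + 1 - i) < v (2 * n + 1 - j)"
            unfolding m(1-4) v_ij using * m(5,6) by linarith+
          moreover have "1 \<le> 2 * n + 1 - j" "2 * n + 1 - j < 2 * n + 1 - i"
            "(2 * n + 1 - j) + (2 * n + 1 - i) \<le> 2 * n + 1"
            using r \<open>i < j\<close> False by linarith+
          ultimately show ?thesis unfolding inversions_def by blast
        qed
        moreover have "f (2 * n + 1 - j, 2 * n + 1 - i) = z"
        proof -
          \<comment> \<open>The mirror image of (x, y) is either (x, y) itself or has too large a
            sum, in which case f mirrors it back.\<close>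
          have "2 * n + 1 - y = x \<and> 2 * n + 1 - x = y \<or>
              \<not> (2 * n + 1 - y) + (2 * n + 1 - x) \<le> 2 * n + 1"
            "2 * n + 1 - (2 * n + 1 - x) = x" "2 * n + 1 - (2 * n + 1 - y) = y"
            using * by linarith+
          then show ?thesis unfolding f_def prod.case m(3,4) v_ij xy by auto
        qed
        ultimately show ?thesis by (metis image_eqI)
      qed
    qed
  qed
  then have "card (inversions n (u \<circ> inv v)) = card (inversions n u - inversions n v)"
    by (simp add: bij_betw_same_card)
  also have "\<dots> = card (inversions n u) - card (inversions n v)"
    using sub finite_inversions by (simp add: card_Diff_subset)
  finally show ?thesis
    using card_mono[OF finite_inversions sub]
    by (simp add: left_weak_le_def coxeter_length_eq u v comp_in_hyperoctahedral
        inv_in_hyperoctahedral)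
qed

text \<open>The two length differences are opposite and both are lengths, so they vanish; an element
  without inversions is given by the empty word.\<close>

lemma left_weak_le_antisym:
  assumes u: "u \<in> hyperoctahedral n" and v: "v \<in> hyperoctahedral n"
    and "left_weak_le n u v" "left_weak_le n v u"
  shows "u = v"
proof -
  have "u \<circ> inv v \<in> hyperoctahedral n" using u v comp_in_hyperoctahedral inv_in_hyperoctahedral by blast
  moreover have "card (inversions n (u \<circ> inv v)) = 0"
    using assms(3,4) coxeter_length_eq[OF calculation] unfolding left_weak_le_def by linarith
  ultimately have "u \<circ> inv v = id" using exists_word_inversions by fastforce
  then have "u (inv v (v x)) = v x" for x by (metis comp_apply id_apply)
  then show ?thesis using hyperoctahedralD(6)[OF v] by auto
qed

section \<open>The permutree order\<close>

lemma permutree_order_less: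
  assumes "(i, j) \<in> permutree_order n w" "i \<noteq> j"
  shows "w i < w j"
  using assms trancl_unobstructedD by (auto simp: permutree_order_def)

lemma permutree_order_range:
  assumes "(i, j) \<in> permutree_order n w"
  shows "i \<in> {1..2 * n}" "j \<in> {1..2 * n}"
  using assms trancl_unobstructedD by (auto simp: permutree_order_def)

text \<open>Double blocking concerns only pairs whose left point is the higher one, so just the
  single-wall conditions remain. Injectivity makes the inequalities strict.\<close>

lemma permutree_order_increasing_iff:
  assumes w: "w \<in> hyperoctahedral n" and ij: "1 \<le> i" "i < j" "j \<le> 2 * n"
  shows "(i, j) \<in> permutree_order n w \<longleftrightarrow> w i < w j \<and>
    (\<forall>k. i < k \<and> k < j \<and> k \<le> n \<longrightarrow> w i < w k) \<and> (\<forall>l. i < l \<and> l < j \<and> n < l \<longrightarrow> w l < w j)"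
proof -
  note W = hyperoctahedralD[OF w]
  have ne: "i < k \<Longrightarrow> w i \<le> w k \<longleftrightarrow> w i < w k" "k < j \<Longrightarrow> w k \<le> w j \<longleftrightarrow> w k < w j" for k
    using W(4) le_less by auto
  show ?thesis
    unfolding permutree_order_iff[OF W(7)]
    using ij not_separated_iff[of w i j n] ne by (auto simp: min_def max_def)
qed

text \<open>The last clause is the absence of double blocking.\<close>

lemma permutree_order_decreasing_iff:
  assumes w: "w \<in> hyperoctahedral n" and ij: "1 \<le> i" "i < j" "j \<le> 2 * n"
  shows "(j, i) \<in> permutree_order n w \<longleftrightarrow> w j < w i \<and>
    (\<forall>k. i < k \<and> k < j \<and> k \<le> n \<longrightarrow> w j < w k) \<and> (\<forall>l. i < l \<and> l < j \<and> n < l \<longrightarrow> w l < w i) \<and>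
    (\<forall>k l. i < k \<and> k \<le> n \<and> n < l \<and> l < j \<longrightarrow> w l < w k)"
proof -
  note W = hyperoctahedralD[OF w]
  have ne: "k < j \<Longrightarrow> w j \<le> w k \<longleftrightarrow> w j < w k" "i < k \<Longrightarrow> w k \<le> w i \<longleftrightarrow> w k < w i"
    "k \<le> n \<Longrightarrow> n < l \<Longrightarrow> w l \<le> w k \<longleftrightarrow> w l < w k" for k l
    using W(4) le_less by auto
  show ?thesis
    unfolding permutree_order_iff[OF W(7)]
    using ij not_separated_iff[of w j i n] ne by (auto simp: min_def max_def Suc_le_eq)
qed

text \<open>Each obstruction is witnessed by relations of the order itself, so it persists in every
  linear extension. The witnesses are the lowest column with an upward wall and the highest one with
  a downward wall between i and j; extremality makes them comparable to the points in
  question.\<close>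

lemma incomparable_cases:
  assumes w: "w \<in> hyperoctahedral n" and ij: "1 \<le> i" "i < j" "j \<le> 2 * n"
    and inc: "(i, j) \<notin> permutree_order n w" "(j, i) \<notin> permutree_order n w"
  obtains (up) k where "i < k" "k < j" "k \<le> n"
      "(k, i) \<in> permutree_order n w" "(k, j) \<in> permutree_order n w"
  | (down) l where "i < l" "l < j" "n < l"
      "(i, l) \<in> permutree_order n w" "(j, l) \<in> permutree_order n w"
  | (both) k l where "i < k" "k \<le> n" "n < l" "l < j" "(k, i) \<in> permutree_order n w"
      "(k, l) \<in> permutree_order n w" "(j, l) \<in> permutree_order n w"
proof -
  note W = hyperoctahedralD[OF w]
  let ?P = "permutree_order n w"
  define U where "U = {k. i < k \<and> k < j \<and> k \<le> n}"
  define D where "D = {l. i < l \<and> l < j \<and> n < l}"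
  have fin: "finite U" "finite D" by (auto simp: U_def D_def intro: finite_subset[of _ "{..<j}"])
  obtain K where K: "U = {} \<or> K \<in> U \<and> (\<forall>k \<in> U. w K \<le> w k)"
    using ex_is_arg_min_if_finite[OF fin(1), of w]
    by (cases "U = {}") (auto simp: is_arg_min_linorder)
  have "\<exists>L. D = {} \<or> L \<in> D \<and> (\<forall>l \<in> D. w l \<le> w L)"
  proof (cases "D = {}")
    case False
    then have "Max (w ` D) \<in> w ` D" using fin by simp
    then obtain L where "L \<in> D" "w L = Max (w ` D)" by force
    then have "L \<in> D \<and> (\<forall>l \<in> D. w l \<le> w L)" using fin by simp
    then show ?thesis by blast
  qed blast
  then obtain L where L: "D = {} \<or> L \<in> D \<and> (\<forall>l \<in> D. w l \<le> w L)" by blast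
  have KU: "i < K \<and> K < j \<and> K \<le> n" if "K \<in> U"
    using that by (auto simp: U_def)
  have LD: "i < L \<and> L < j \<and> n < L" if "L \<in> D"
    using that by (auto simp: D_def)
  have Kmin: "w K < w k" if "K \<in> U" "i < k" "k < j" "k \<le> n" "k \<noteq> K" for k
    using K that W(4)[of K k] by (fastforce simp: U_def le_less)
  have Lmax: "w l < w L" if "L \<in> D" "i < l" "l < j" "n < l" "l \<noteq> L" for l
    using L that W(4)[of l L] by (fastforce simp: D_def le_less)
  have Ki: "(K, i) \<in> ?P" if "K \<in> U" "w K < w i"
    using permutree_order_decreasing_iff[OF w, of i K] KU[OF that(1)] Kmin[OF that(1)] that ij
    by simp
  have jL: "(j, L) \<in> ?P" if "L \<in> D" "w j < w L"
    using permutree_order_decreasing_iff[OF w, of L j] LD[OF that(1)] Lmax[OF that(1)] that ij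
    by simp
  have Kj: "(K, j) \<in> ?P" if "K \<in> U" "w K < w j" "D = {} \<or> w L < w j"
  proof -
    have "w l < w j" if "i < l \<and> l < j \<and> n < l" for l
      using \<open>D = {} \<or> w L < w j\<close> L that unfolding D_def by fastforce
    then show ?thesis
      using permutree_order_increasing_iff[OF w, of K j] KU[OF that(1)] Kmin[OF that(1)] that ij
      by simp
  qed
  have iL: "(i, L) \<in> ?P" if "L \<in> D" "w i < w L" "U = {} \<or> w i < w K"
  proof -
    have "w i < w k" if "i < k \<and> k < j \<and> k \<le> n" for k
      using \<open>U = {} \<or> w i < w K\<close> K that unfolding U_def by fastforce
    then show ?thesis
      using permutree_order_increasing_iff[OF w, of i L] LD[OF that(1)] Lmax[OF that(1)] that ij
      by simp
  qed
  have KL: "(K, L) \<in> ?P" if "K \<in> U" "L \<in> D" "w K < w L"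
    using permutree_order_increasing_iff[OF w, of K L] KU[OF that(1)] LD[OF that(2)]
      Kmin[OF that(1)] Lmax[OF that(2)] that ij
    by simp
  \<comment> \<open>The conditions on all columns between i and j reduce to the extremal columns K
    and L; if U or D is empty, K or L is arbitrary and the condition is vacuous.\<close>
  have all: "(\<forall>k. i < k \<and> k < j \<and> k \<le> n \<longrightarrow> x < w k) \<longleftrightarrow> U = {} \<or> x < w K"
    "(\<forall>l. i < l \<and> l < j \<and> n < l \<longrightarrow> w l < x) \<longleftrightarrow> D = {} \<or> w L < x" for x
    using K L unfolding U_def D_def by (auto intro: less_le_trans le_less_trans)
  have UD: "(\<forall>k l. i < k \<and> k \<le> n \<and> n < l \<and> l < j \<longrightarrow> w l < w k)" if "U = {} \<or> D = {} \<or> w L < w K"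
  proof (intro allI impI)
    fix k l assume "i < k \<and> k \<le> n \<and> n < l \<and> l < j"
    then have "k \<in> U" "l \<in> D" by (auto simp: U_def D_def)
    then show "w l < w k" using that K L by fastforce
  qed
  have N: "\<not> (w i < w j \<and> (U = {} \<or> w i < w K) \<and> (D = {} \<or> w L < w j))"
    using inc(1) unfolding permutree_order_increasing_iff[OF w ij] all by simp
  have N': "\<not> (w j < w i \<and> (U = {} \<or> w j < w K) \<and> (D = {} \<or> w L < w i) \<and>
      (U = {} \<or> D = {} \<or> w L < w K))"
    using inc(2) UD unfolding permutree_order_decreasing_iff[OF w ij] all by (elim contrapos_nn) simp
  have ne: "w i \<noteq> w j" using W(4) ij by simp
  have neU: "w K \<noteq> w i \<and> w K \<noteq> w j" if "K \<in> U" using KU[OF that] W(4) by auto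
  have neD: "w L \<noteq> w i \<and> w L \<noteq> w j" if "L \<in> D" using LD[OF that] W(4) by auto
  have neUD: "w K \<noteq> w L" if "K \<in> U" "L \<in> D" using KU[OF that(1)] LD[OF that(2)] W(4) by auto
  \<comment> \<open>The third alternative includes double blocking, where neither wall alone
    separates i from j.\<close>
  consider "K \<in> U" "w K < w i" "w K < w j" "D = {} \<or> w L < w j"
    | "L \<in> D" "w i < w L" "w j < w L" "U = {} \<or> w i < w K"
    | "K \<in> U" "L \<in> D" "w K < w i" "w K < w L" "w j < w L"
    using N N' ne neU neD neUD K L
    by (smt (verit) linorder_neqE_nat order.strict_trans)
  then show thesis
  proof cases
    case 1 then show thesis using up[of K] KU Ki Kj by blast
  next
    case 2 then show thesis using down[of L] LD iL jL by blast
  next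
    case 3 then show thesis using both[of K L] KU LD Ki KL jL by blast
  qed
qed

text \<open>In an unobstructed pair (i, j) of w, every upward wall between the columns starts at a
  point above j in the order, every downward wall at a point below i. A linear extension keeps these
  relations, so the pair stays unobstructed.\<close>

lemma permutree_order_subset_linear_extension:
  assumes w: "w \<in> hyperoctahedral n"
    and ext: "\<And>i j. (i, j) \<in> permutree_order n w \<Longrightarrow> i \<noteq> j \<Longrightarrow> u i < u j"
  shows "permutree_order n w \<subseteq> permutree_order n u"
proof -
  note W = hyperoctahedralD[OF w]
  have "(i, j) \<in> unobstructed n u" if "(i, j) \<in> unobstructed n w" for i j
  proof -
    note D = unobstructedD[OF that]
    have "(i, j) \<in> permutree_order n w" using that by (auto simp: permutree_order_def)
    then have uij: "u i < u j" using ext D(3) by blast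
    have "wall n u k \<inter> {u i..u j} = {}" if k: "min i j < k" "k < max i j" for k
    proof (cases "k \<le> n")
      case True
      have jk: "w j < w k" using D(4)[OF k True] W(4)[of j k] k by (auto simp: le_less)
      \<comment> \<open>Columns between j and k also lie between i and j, so unobstructedness of (i,
        j) supplies all bounds.\<close>
      have "(j, k) \<in> permutree_order n w"
        unfolding permutree_order_iff[OF W(7)] not_separated_iff[where n = n and w = w, OF jk]
      proof (intro conjI disjI2 allI impI)
        show "j \<in> {1..2 * n}" "k \<in> {1..2 * n}" using D(1,2) k by auto
        show "w j < w k" by (rule jk)
        show "w j \<le> w m" if "min j k < m \<and> m < max j k \<and> m \<le> n" for m
          using D(4)[of m] that k by (auto simp: min_def max_def split: if_splits)
        show "w l \<le> w k" if "min j k < l \<and> l < max j k \<and> n + 1 \<le> l" for l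
          using D(5)[of l] that k D(3) jk by (auto simp: min_def max_def split: if_splits)
        show "w l \<le> w m" if "k < m \<and> m \<le> n \<and> n + 1 \<le> l \<and> l < j" for m l
          using D(4)[of m] D(5)[of l] that k D(3) by (auto simp: min_def max_def split: if_splits)
      qed
      then have "u j < u k" using ext jk by blast
      then show ?thesis using True by (auto simp: wall_def)
    next
      case False
      have "w k \<le> w i" "k \<noteq> i" using D(5)[OF k] False k by linarith+
      then have ki: "w k < w i" using W(4)[of k i] by linarith
      have "(k, i) \<in> permutree_order n w"
        unfolding permutree_order_iff[OF W(7)] not_separated_iff[where n = n and w = w, OF ki]
      proof (intro conjI disjI2 allI impI)
        show "i \<in> {1..2 * n}" "k \<in> {1..2 * n}" using D(1,2) k by auto
        show "w k < w i" by (rule ki)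
        show "w k \<le> w m" if "min k i < m \<and> m < max k i \<and> m \<le> n" for m
          using D(4)[of m] that k D(3) ki by (auto simp: min_def max_def split: if_splits)
        show "w l \<le> w i" if "min k i < l \<and> l < max k i \<and> n + 1 \<le> l" for l
          using D(5)[of l] that k by (auto simp: min_def max_def split: if_splits)
        show "w l \<le> w m" if "i < m \<and> m \<le> n \<and> n + 1 \<le> l \<and> l < k" for m l
          using D(4)[of m] D(5)[of l] that k D(3) by (auto simp: min_def max_def split: if_splits)
      qed
      then have "u k < u i" using ext ki by blast
      then show ?thesis using False by (auto simp: wall_def)
    qed
    then show ?thesis using D(1,2) uij by (simp add: unobstructed_def)
  qed
  then have "unobstructed n w \<subseteq> unobstructed n u" by auto
  then have "(unobstructed n w)\<^sup>+ \<subseteq> (unobstructed n u)\<^sup>+" by (simp add: trancl_mono_subset)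
  then show ?thesis by (auto simp: permutree_order_def)
qed

text \<open>Every linear extension lying in B_n belongs to the class: comparable pairs persist by
  the preceding lemma, incomparable ones because the witnesses of \<open>incomparable_cases\<close>
  still obstruct.\<close>

lemma permutree_order_linear_extension:
  assumes w: "w \<in> hyperoctahedral n" and u: "u \<in> hyperoctahedral n"
    and ext: "\<And>i j. (i, j) \<in> permutree_order n w \<Longrightarrow> i \<noteq> j \<Longrightarrow> u i < u j"
  shows "permutree_order n u = permutree_order n w"
proof
  show sub: "permutree_order n w \<subseteq> permutree_order n u"
    using w ext by (rule permutree_order_subset_linear_extension)
  have inc: "(i, j) \<notin> permutree_order n u \<and> (j, i) \<notin> permutree_order n u"
    if ij: "1 \<le> i" "i < j" "j \<le> 2 * n"
      and no: "(i, j) \<notin> permutree_order n w" "(j, i) \<notin> permutree_order n w" for i j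
    using w ij no
  proof (cases rule: incomparable_cases)
    case (up k)
    then have "u k < u i" "u k < u j" using ext by auto
    then show ?thesis
      using up permutree_order_increasing_iff[OF u ij] permutree_order_decreasing_iff[OF u ij]
      by (meson order.asym)
  next
    case (down l)
    then have "u i < u l" "u j < u l" using ext by auto
    then show ?thesis
      using down permutree_order_increasing_iff[OF u ij] permutree_order_decreasing_iff[OF u ij]
      by (meson order.asym)
  next
    case (both k l)
    then have "u k < u i" "u k < u l" "i < k" "k < j" using ext by auto
    then show ?thesis
      using both permutree_order_increasing_iff[OF u ij] permutree_order_decreasing_iff[OF u ij]
      by (meson order.asym)
  qed
  show "permutree_order n u \<subseteq> permutree_order n w"
  proof (rule subrelI, rule ccontr)
    fix i j assume ij: "(i, j) \<in> permutree_order n u" "(i, j) \<notin> permutree_order n w"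
    have r: "i \<in> {1..2 * n}" "j \<in> {1..2 * n}" using permutree_order_range[OF ij(1)] by auto
    have ne: "i \<noteq> j" using ij r by (auto simp: permutree_order_def)
    have "(j, i) \<notin> permutree_order n w"
      using ext[of j i] permutree_order_less[OF ij(1) ne] ne by auto
    then show False
      using inc[of i j] inc[of j i] r ne ij by (cases "i < j") auto
  qed
qed

section \<open>The minimal element of a class\<close>

text \<open>If the order forces all inversions of v, every member of the class has them. Then v lies
  below the whole class, and by antisymmetry it is the only minimal element.\<close>

lemma pi_down_eqI:
  assumes v: "v \<in> sylvester_class n w"
    and min: "\<And>i j. 1 \<le> i \<Longrightarrow> i < j \<Longrightarrow> j \<le> 2 * n \<Longrightarrow> v j < v i \<Longrightarrow> (j, i) \<in> permutree_order n w"
  shows "pi_down n w = v"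
proof -
  have vH: "v \<in> hyperoctahedral n" using v by (simp add: sylvester_class_def)
  have le: "left_weak_le n v u" if "u \<in> sylvester_class n w" for u
  proof (rule left_weak_leI)
    show "u \<in> hyperoctahedral n" using that by (simp add: sylvester_class_def)
    show "inversions n v \<subseteq> inversions n u"
    proof (rule subrelI)
      fix i j assume ij: "(i, j) \<in> inversions n v"
      then have "(j, i) \<in> permutree_order n u" "i \<noteq> j"
        using min[of i j] that by (auto simp: inversions_def sylvester_class_def)
      then show "(i, j) \<in> inversions n u"
        using ij permutree_order_less[of j i n u] by (auto simp: inversions_def)
    qed
  qed (rule vH)
  show ?thesis
    unfolding pi_down_def
  proof (rule the_equality)
    show "v \<in> sylvester_class n w \<and> (\<forall>u \<in> sylvester_class n w. left_weak_le n u v \<longrightarrow> u = v)"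
      using v le left_weak_le_antisym[OF _ vH] by (auto simp: sylvester_class_def)
  next
    fix v' assume "v' \<in> sylvester_class n w \<and>
      (\<forall>u \<in> sylvester_class n w. left_weak_le n u v' \<longrightarrow> u = v')"
    then show "v' = v" using v le by blast
  qed
qed

text \<open>The half turn of the diagram exchanges the columns up to n with those beyond n and
  reverses heights, so it exchanges upward and downward walls.\<close>

lemma permutree_order_mirror:
  assumes w: "w \<in> hyperoctahedral n" and ij: "(i, j) \<in> permutree_order n w"
  shows "(2 * n + 1 - j, 2 * n + 1 - i) \<in> permutree_order n w"
proof -
  note W = hyperoctahedralD[OF w]
  have step: "(2 * n + 1 - j, 2 * n + 1 - i) \<in> unobstructed n w" if "(i, j) \<in> unobstructed n w" for i j
  proof -
    note D = unobstructedD[OF that]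
    note m = W(3)[of i] W(3)[of j] W(2)[of i] W(2)[of j]
    have less: "w (2 * n + 1 - j) < w (2 * n + 1 - i)" using m D(1-3) by simp
    have "wall n w k \<inter> {w (2 * n + 1 - j)..w (2 * n + 1 - i)} = {}"
      if k: "min (2 * n + 1 - j) (2 * n + 1 - i) < k" "k < max (2 * n + 1 - j) (2 * n + 1 - i)" for k
    proof -
      define k' where "k' = 2 * n + 1 - k"
      have k': "min i j < k'" "k' < max i j" "1 \<le> k" "k \<le> 2 * n" "1 \<le> k'" "k' \<le> 2 * n"
        using k D(1,2) by (auto simp: k'_def min_def max_def split: if_splits)
      have wk: "w k = 2 * n + 1 - w k'" "1 \<le> w k'" "w k' \<le> 2 * n"
        using W(3)[of k'] W(2)[of k'] k' by (auto simp: k'_def)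
      show ?thesis
      proof (cases "k \<le> n")
        case True
        then have "n + 1 \<le> k'" unfolding k'_def by linarith
        then have "w k' \<le> w i" "k' \<noteq> i" using D(5)[OF k'(1,2)] k'(1,2) by linarith+
        then have "w k' < w i" using W(4)[of k' i] by linarith
        then have "w (2 * n + 1 - i) < w k" using wk m D(1) by simp
        then show ?thesis using True by (auto simp: wall_def)
      next
        case False
        then have "k' \<le> n" unfolding k'_def by linarith
        then have "w j \<le> w k'" "k' \<noteq> j" using D(4)[OF k'(1,2)] k'(1,2) by linarith+
        then have "w j < w k'" using W(4)[of j k'] by linarith
        then have "w k < w (2 * n + 1 - j)" using wk m D(2) by simp
        then show ?thesis using False by (auto simp: wall_def)
      qed
    qed
    then show ?thesis using D(1,2) less by (auto simp: unobstructed_def)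
  qed
  have "(2 * n + 1 - j, 2 * n + 1 - i) \<in> (unobstructed n w)\<^sup>+" if "(i, j) \<in> (unobstructed n w)\<^sup>+" for i j
    using that by (induction rule: trancl_induct) (blast intro: step trancl_into_trancl2)+
  then show ?thesis using ij by (auto simp: permutree_order_def)
qed

text \<open>
  Incomparable columns are ordered from left to right. The resulting total order is the minimal
  linear extension of the permutree order, because the inversions in it are the forced ones.
\<close>

definition pi_rel :: "nat \<Rightarrow> (nat \<Rightarrow> nat) \<Rightarrow> nat \<Rightarrow> nat \<Rightarrow> bool" where
  "pi_rel n w i j \<longleftrightarrow> i \<noteq> j \<and> ((i, j) \<in> permutree_order n w \<or> i < j \<and> (j, i) \<notin> permutree_order n w)"

lemma pi_rel_total: "i \<noteq> j \<Longrightarrow> pi_rel n w i j \<or> pi_rel n w j i"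
  by (auto simp: pi_rel_def)

lemma permutree_order_antisym:
  "(i, j) \<in> permutree_order n w \<Longrightarrow> (j, i) \<in> permutree_order n w \<Longrightarrow> i = j"
  using permutree_order_less[of i j n w] permutree_order_less[of j i n w] by force

lemma pi_rel_asym: "pi_rel n w i j \<Longrightarrow> \<not> pi_rel n w j i"
  using permutree_order_antisym by (auto simp: pi_rel_def)

text \<open>A column strictly inside a forced inversion takes part in a forced inversion with one of
  its ends, chosen by the direction of its wall. This excludes cycles of length three in
  \<open>pi_rel\<close>.\<close>

lemma permutree_order_chord:
  assumes w: "w \<in> hyperoctahedral n" and xyz: "1 \<le> x" "x < y" "y < z" "z \<le> 2 * n"
    and zx: "(z, x) \<in> permutree_order n w"
  shows "(z, y) \<in> permutree_order n w \<or> (y, x) \<in> permutree_order n w"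
proof -
  note zx = zx[unfolded permutree_order_decreasing_iff[OF w xyz(1) order.strict_trans[OF xyz(2,3)] xyz(4)]]
  show ?thesis
  proof (cases "y \<le> n")
    case True
    then have "(z, y) \<in> permutree_order n w"
      using permutree_order_decreasing_iff[OF w, of y z] zx xyz by auto
    then show ?thesis ..
  next
    case False
    then have "(y, x) \<in> permutree_order n w"
      using permutree_order_decreasing_iff[OF w, of x y] zx xyz by auto
    then show ?thesis ..
  qed
qed

lemma pi_rel_trans:
  assumes w: "w \<in> hyperoctahedral n"
    and r: "x \<in> {1..2 * n}" "y \<in> {1..2 * n}" "z \<in> {1..2 * n}"
    and xy: "pi_rel n w x y" and yz: "pi_rel n w y z"
  shows "pi_rel n w x z"
proof (rule ccontr)
  assume no: "\<not> pi_rel n w x z"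
  have "x \<noteq> z" using xy yz pi_rel_asym by blast
  then have zx: "pi_rel n w z x" using no pi_rel_total by blast
  have trans: "(a, c) \<in> permutree_order n w"
    if "(a, b) \<in> permutree_order n w" "(b, c) \<in> permutree_order n w" for a b c
    using that partial_order_permutree_order[of n w]
    unfolding partial_order_on_def preorder_on_def trans_def by blast
  \<comment> \<open>If one edge of a 3-cycle is an order relation, transitivity keeps the other two
    from being so; those run from left to right, and the chord lemma applies. A cycle with no order
    relation would give x < y < z < x.\<close>
  have cycle: False
    if c: "c \<in> {1..2 * n}" "a \<in> {1..2 * n}" "pi_rel n w a b" "pi_rel n w b c"
      "(c, a) \<in> permutree_order n w" for a b c
  proof -
    have "(a, b) \<notin> permutree_order n w"
    proof
      assume "(a, b) \<in> permutree_order n w"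
      then have "(c, b) \<in> permutree_order n w" using c trans by blast
      then show False using c(4) permutree_order_antisym by (auto simp: pi_rel_def)
    qed
    moreover have "(b, c) \<notin> permutree_order n w"
    proof
      assume "(b, c) \<in> permutree_order n w"
      then have "(b, a) \<in> permutree_order n w" using c trans by blast
      then show False using c(3) permutree_order_antisym by (auto simp: pi_rel_def)
    qed
    ultimately show False
      using c permutree_order_chord[OF w, of a b c] by (auto simp: pi_rel_def)
  qed
  have "(x, y) \<notin> permutree_order n w" "(y, z) \<notin> permutree_order n w" "(z, x) \<notin> permutree_order n w"
    using cycle r xy yz zx by blast+
  then show False using xy yz zx by (auto simp: pi_rel_def)
qed

lemma pi_rel_mirror:
  assumes w: "w \<in> hyperoctahedral n" and r: "i \<in> {1..2 * n}" "j \<in> {1..2 * n}"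
    and ij: "pi_rel n w i j"
  shows "pi_rel n w (2 * n + 1 - j) (2 * n + 1 - i)"
proof -
  have "(2 * n + 1 - i, 2 * n + 1 - j) \<in> permutree_order n w \<longrightarrow> (j, i) \<in> permutree_order n w"
    using permutree_order_mirror[OF w, of "2 * n + 1 - i" "2 * n + 1 - j"] r by auto
  then show ?thesis
    using ij permutree_order_mirror[OF w, of i j] r unfolding pi_rel_def by auto
qed

definition pi_perm :: "nat \<Rightarrow> (nat \<Rightarrow> nat) \<Rightarrow> nat \<Rightarrow> nat" where
  "pi_perm n w j = (if j \<in> {1..2 * n} then card {i \<in> {1..2 * n}. pi_rel n w i j} + 1 else j)"

lemma pi_perm_less:
  assumes w: "w \<in> hyperoctahedral n" and r: "i \<in> {1..2 * n}" "j \<in> {1..2 * n}"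
    and ij: "pi_rel n w i j"
  shows "pi_perm n w i < pi_perm n w j"
proof -
  have "{x \<in> {1..2 * n}. pi_rel n w x i} \<subset> {x \<in> {1..2 * n}. pi_rel n w x j}"
    using pi_rel_trans[OF w _ r _ ij] ij r pi_rel_asym by blast
  then have "card {x \<in> {1..2 * n}. pi_rel n w x i} < card {x \<in> {1..2 * n}. pi_rel n w x j}"
    by (intro psubset_card_mono) auto
  then show ?thesis using r by (simp add: pi_perm_def)
qed

lemma pi_perm_in_hyperoctahedral:
  assumes w: "w \<in> hyperoctahedral n"
  shows "pi_perm n w \<in> hyperoctahedral n"
proof -
  let ?I = "{1..2 * n}"
  let ?c = "\<lambda>i. card {x \<in> ?I. pi_rel n w x i}"
  have split: "?c i + card {x \<in> ?I. pi_rel n w i x} = 2 * n - 1" if "i \<in> ?I" for i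
  proof -
    have "{x \<in> ?I. pi_rel n w x i} \<union> {x \<in> ?I. pi_rel n w i x} = ?I - {i}"
      using pi_rel_total by (auto simp: pi_rel_def)
    moreover have "{x \<in> ?I. pi_rel n w x i} \<inter> {x \<in> ?I. pi_rel n w i x} = {}"
      using pi_rel_asym by auto
    ultimately have "?c i + card {x \<in> ?I. pi_rel n w i x} = card (?I - {i})"
      by (metis (no_types, lifting) card_Un_disjoint finite_Diff finite_Un finite_atLeastAtMost)
    then show ?thesis using that by simp
  qed
  have inj: "inj_on (pi_perm n w) ?I"
    by (rule inj_onI) (metis pi_perm_less[OF w] pi_rel_total less_irrefl)
  have sub: "pi_perm n w ` ?I \<subseteq> ?I"
    using split by (force simp: pi_perm_def)
  have "bij_betw (pi_perm n w) ?I ?I"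
    using inj sub by (simp add: bij_betw_def endo_inj_surj)
  then have "pi_perm n w permutes ?I"
    by (rule bij_imp_permutes) (auto simp: pi_perm_def)
  moreover have "pi_perm n w (2 * n + 1 - i) = 2 * n + 1 - pi_perm n w i" if i: "i \<in> ?I" for i
  proof -
    \<comment> \<open>Mirroring exchanges predecessors and successors, and these two sets together
      have 2n - 1 elements.\<close>
    have "{x \<in> ?I. pi_rel n w x (2 * n + 1 - i)} = (\<lambda>x. 2 * n + 1 - x) ` {x \<in> ?I. pi_rel n w i x}"
    proof (intro equalityI subsetI)
      fix x assume "x \<in> {x \<in> ?I. pi_rel n w x (2 * n + 1 - i)}"
      then show "x \<in> (\<lambda>x. 2 * n + 1 - x) ` {x \<in> ?I. pi_rel n w i x}"
        using pi_rel_mirror[OF w, of x "2 * n + 1 - i"] i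
        by (intro image_eqI[of _ _ "2 * n + 1 - x"]) force+
    next
      fix x assume "x \<in> (\<lambda>x. 2 * n + 1 - x) ` {x \<in> ?I. pi_rel n w i x}"
      then show "x \<in> {x \<in> ?I. pi_rel n w x (2 * n + 1 - i)}"
        using pi_rel_mirror[OF w i] by auto
    qed
    then have "?c (2 * n + 1 - i) = card {x \<in> ?I. pi_rel n w i x}"
      by (simp only:) (rule card_image, auto intro!: inj_onI)
    then show ?thesis using split[OF i] i by (auto simp: pi_perm_def)
  qed
  ultimately show ?thesis by (simp add: hyperoctahedral_def)
qed

text \<open>\<open>pi_perm\<close> ranks the columns by \<open>pi_rel\<close>. It extends the
  permutree order, hence lies in the class, and \<open>pi_rel\<close> puts a right column before a
  left one only when the order says so.\<close>

lemma pi_down: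
  assumes w: "w \<in> hyperoctahedral n"
  shows pi_down_in_class: "pi_down n w \<in> sylvester_class n w"
    and pi_down_inversion: "\<And>i j. 1 \<le> i \<Longrightarrow> i < j \<Longrightarrow> j \<le> 2 * n \<Longrightarrow>
      pi_down n w j < pi_down n w i \<Longrightarrow> (j, i) \<in> permutree_order n w"
proof -
  have H: "pi_perm n w \<in> hyperoctahedral n" using w by (rule pi_perm_in_hyperoctahedral)
  have "pi_perm n w i < pi_perm n w j" if "(i, j) \<in> permutree_order n w" "i \<noteq> j" for i j
    using pi_perm_less[OF w permutree_order_range[OF that(1)]] that by (simp add: pi_rel_def)
  then have cls: "pi_perm n w \<in> sylvester_class n w"
    using permutree_order_linear_extension[OF w H] H by (simp add: sylvester_class_def)
  have inv: "(j, i) \<in> permutree_order n w"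
    if "1 \<le> i" "i < j" "j \<le> 2 * n" "pi_perm n w j < pi_perm n w i" for i j
    using pi_perm_less[OF w, of i j] that unfolding pi_rel_def by force
  have eq: "pi_down n w = pi_perm n w" using pi_down_eqI[OF cls inv] .
  show "pi_down n w \<in> sylvester_class n w" using cls by (simp add: eq)
  show "\<And>i j. 1 \<le> i \<Longrightarrow> i < j \<Longrightarrow> j \<le> 2 * n \<Longrightarrow>
      pi_down n w j < pi_down n w i \<Longrightarrow> (j, i) \<in> permutree_order n w"
    using inv by (simp add: eq)
qed

section \<open>The upper bound\<close>

text \<open>The range goes up to 2n - 1 because a descent at a caused by a downward wall is recorded
  at 2n - a, where the mirrored wall points upwards.\<close>

definition up_blocked :: "nat \<Rightarrow> (nat \<Rightarrow> nat) \<Rightarrow> nat set" where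
  "up_blocked n v = {a. 1 \<le> a \<and> a < 2 * n \<and>
     (\<exists>k. inv v a < k \<and> k < inv v (a + 1) \<and> k \<le> n \<and> v k < a)}"

lemma card_up_blocked:
  assumes v: "v \<in> hyperoctahedral n"
    and inversion: "\<And>i j. 1 \<le> i \<Longrightarrow> i < j \<Longrightarrow> j \<le> 2 * n \<Longrightarrow> v j < v i \<Longrightarrow>
      (j, i) \<in> permutree_order n v"
  shows "2 * card (up_blocked n v) \<le> n"
proof -
  note V = hyperoctahedralD[OF v] and IV = hyperoctahedralD[OF inv_in_hyperoctahedral[OF v]]
  let ?p = "inv v"
  \<comment> \<open>An inversion of v is a comparable pair, so no upward wall between its columns
    starts below it.\<close>
  have no_wall: "v j < v k" if "1 \<le> i" "i < k" "k < j" "j \<le> 2 * n" "v j < v i" "k \<le> n" for i j k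
    using inversion[of i j] permutree_order_decreasing_iff[OF v, of i j] that by auto
  have "\<forall>a \<in> up_blocked n v. \<exists>k.
      1 \<le> a \<and> a < 2 * n \<and> ?p a < k \<and> k < ?p (a + 1) \<and> k \<le> n \<and> v k < a"
    by (auto simp: up_blocked_def)
  then obtain k where k: "\<And>a. a \<in> up_blocked n v \<Longrightarrow>
      1 \<le> a \<and> a < 2 * n \<and> ?p a < k a \<and> k a < ?p (a + 1) \<and> k a \<le> n \<and> v (k a) < a"
    using bchoice by metis
  have r: "1 \<le> ?p a" "?p (a + 1) \<le> 2 * n" if "a \<in> up_blocked n v" for a
    using IV(2)[of a] IV(2)[of "a + 1"] k[OF that] by auto
  \<comment> \<open>With a common column, the value b lies to its left and the smaller value a + 1
    to its right: an inversion of v around an upward wall that starts below a.\<close>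
  have k_inj: "k a \<noteq> k b" if ab: "a \<in> up_blocked n v" "b \<in> up_blocked n v" "a < b" for a b
  proof
    assume eq: "k a = k b"
    have "b \<noteq> a + 1" using k[OF ab(1)] k[OF ab(2)] eq by auto
    then have "v (?p (a + 1)) < v (?p b)" using V(5) ab by simp
    then have "v (?p (a + 1)) < v (k a)"
      using no_wall[of "?p b" "k a" "?p (a + 1)"] k[OF ab(1)] k[OF ab(2)] eq r ab by auto
    then show False using k[OF ab(1)] V(5) by simp
  qed
  \<comment> \<open>Here a = v (k b) < b, and the values b and a + 1 form an inversion around the
    column of a, whose upward wall starts below both.\<close>
  have disj: "?p a \<noteq> k b" if ab: "a \<in> up_blocked n v" "b \<in> up_blocked n v" for a b
  proof
    assume eq: "?p a = k b"
    then have "a < b" using k[OF ab(2)] V(5) by metis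
    moreover have "b \<noteq> a + 1" using k[OF ab(1)] k[OF ab(2)] eq by auto
    ultimately have "v (?p (a + 1)) < v (?p b)" using V(5) by simp
    then have "v (?p (a + 1)) < v (k b)"
      using no_wall[of "?p b" "k b" "?p (a + 1)"] k[OF ab(1)] k[OF ab(2)] eq r ab by auto
    then show False using eq V(5) by (metis less_add_one order.asym)
  qed
  have fin: "finite (up_blocked n v)" by (rule finite_subset[of _ "{..2 * n}"]) (auto simp: up_blocked_def)
  have "card (?p ` up_blocked n v \<union> k ` up_blocked n v) = 2 * card (up_blocked n v)"
  proof -
    have "inj_on ?p (up_blocked n v)" using IV(4) by (auto intro: inj_onI)
    moreover have "inj_on k (up_blocked n v)" by (rule inj_onI) (metis k_inj linorder_neqE_nat)
    moreover have "?p ` up_blocked n v \<inter> k ` up_blocked n v = {}" using disj by blast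
    ultimately show ?thesis using fin by (simp add: card_Un_disjoint card_image)
  qed
  moreover have "?p ` up_blocked n v \<union> k ` up_blocked n v \<subseteq> {1..n}"
    using k r by fastforce
  ultimately show ?thesis
    using card_mono[of "{1..n}" "?p ` up_blocked n v \<union> k ` up_blocked n v"] by simp
qed

lemma card_right_descents_stack_sort:
  assumes w: "w \<in> hyperoctahedral n"
  shows "card (right_descents n (stack_sort n w)) \<le> n div 2"
proof -
  define v where "v = pi_down n w"
  have v: "v \<in> hyperoctahedral n" and eq: "permutree_order n v = permutree_order n w"
    using pi_down_in_class[OF w] by (auto simp: v_def sylvester_class_def)
  have inversion: "(j, i) \<in> permutree_order n v" if "1 \<le> i" "i < j" "j \<le> 2 * n" "v j < v i" for i j
    using pi_down_inversion[OF w] that by (auto simp: v_def[symmetric] eq)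
  note V = hyperoctahedralD[OF v] and IV = hyperoctahedralD[OF inv_in_hyperoctahedral[OF v]]
  let ?p = "inv v"
  define A where "A = {a. 1 \<le> a \<and> a \<le> n \<and> w (?p (a + 1)) < w (?p a)}"
  have A: "a \<in> up_blocked n v \<or> 2 * n - a \<in> up_blocked n v" if "a \<in> A" for a
  proof -
    have a: "1 \<le> a" "a \<le> n" "w (?p (a + 1)) < w (?p a)" using that by (auto simp: A_def)
    have r: "1 \<le> ?p a" "?p a \<le> 2 * n" "1 \<le> ?p (a + 1)" "?p (a + 1) \<le> 2 * n"
      using IV(2)[of a] IV(2)[of "a + 1"] a by auto
    have ne: "?p a \<noteq> ?p (a + 1)" using IV(4) by simp
    have "(?p a, ?p (a + 1)) \<notin> permutree_order n v"
      using permutree_order_less[of "?p a" "?p (a + 1)" n w] ne a by (auto simp: eq)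
    \<comment> \<open>In the other order a + 1 and a would form an inversion of v, hence a
      comparable pair, and w would keep their order.\<close>
    moreover have lt: "?p a < ?p (a + 1)"
      using inversion[of "?p (a + 1)" "?p a"] calculation r ne V(5) by force
    ultimately have "\<exists>k. ?p a < k \<and> k < ?p (a + 1) \<and> (k \<le> n \<and> \<not> a < v k \<or> n < k \<and> \<not> v k < a + 1)"
      using permutree_order_increasing_iff[OF v r(1) lt r(4)] V(5) by auto
    then obtain k where k: "?p a < k" "k < ?p (a + 1)" "k \<le> n \<and> \<not> a < v k \<or> n < k \<and> \<not> v k < a + 1"
      by blast
    have "v k \<noteq> a" "v k \<noteq> a + 1" using k V(6)[of k] by auto
    then consider "k \<le> n" "v k < a" | "n < k" "a + 1 < v k" using k(3) by linarith
    then show ?thesis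
    proof cases
      case 1
      then have "a \<in> up_blocked n v" using a k by (auto simp: up_blocked_def)
      then show ?thesis ..
    next
      case 2
      have "?p (2 * n - a) = 2 * n + 1 - ?p (a + 1)" "?p (2 * n - a + 1) = 2 * n + 1 - ?p a"
        using IV(3)[of "a + 1"] IV(3)[of a] a by (auto simp: Suc_diff_le)
      moreover have "v (2 * n + 1 - k) = 2 * n + 1 - v k" using V(3)[of k] k r by simp
      ultimately have "2 * n - a \<in> up_blocked n v"
        using a k 2 r unfolding up_blocked_def mem_Collect_eq
        by (intro conjI exI[of _ "2 * n + 1 - k"]) linarith+
      then show ?thesis ..
    qed
  qed
  have fin: "finite (up_blocked n v)" by (rule finite_subset[of _ "{..2 * n}"]) (auto simp: up_blocked_def)
  \<comment> \<open>Since a <= n <= 2n - a on A, the two branches can agree only at a = n, so g is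
    injective.\<close>
  define g where "g a = (if a \<in> up_blocked n v then a else 2 * n - a)" for a
  have "inj_on g A"
  proof (rule inj_onI)
    fix a b assume "a \<in> A" "b \<in> A" "g a = g b"
    moreover have "a \<le> n" "b \<le> n" using calculation by (auto simp: A_def)
    ultimately show "a = b" by (auto simp: g_def split: if_splits)
  qed
  moreover have "g ` A \<subseteq> up_blocked n v" using A by (auto simp: g_def)
  ultimately have "card A \<le> card (up_blocked n v)" using fin by (metis card_inj_on_le)
  moreover have "right_descents n (stack_sort n w) = simple_gen n ` A"
    by (auto simp: right_descents_def stack_sort_def A_def v_def)
  then have "card (right_descents n (stack_sort n w)) \<le> card A"
    by (simp add: card_image_le A_def)
  ultimately show ?thesis using card_up_blocked[OF v inversion] by linarith
qed

section \<open>The extremal permutation\<close>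

text \<open>The intended image of \<open>extremal n\<close> under stack-sorting: it reverses the 2 *
  (n div 2) central values and so descends at each a with n - n div 2 < a <= n.\<close>

definition reverse_middle :: "nat \<Rightarrow> nat \<Rightarrow> nat" where
  "reverse_middle n x = (if n - n div 2 < x \<and> x \<le> n + n div 2 then 2 * n + 1 - x else x)"

text \<open>From column n leftwards, small values 1, 2, ... alternate with n + 1, n + 2, ...; for n
  = 4 the one-line notation of \<open>extremal\<close> is 6 2 5 1 8 4 7 3.\<close>

definition half_extremal :: "nat \<Rightarrow> nat \<Rightarrow> nat" where
  "half_extremal n j =
     (if even (n - j) then 1 + (n - j) div 2 else n + 1 + (n - j) div 2)"

definition extremal :: "nat \<Rightarrow> nat \<Rightarrow> nat" where
  "extremal n j = (if j \<in> {1..n} then half_extremal n j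
     else if j \<in> {n<..2 * n} then 2 * n + 1 - half_extremal n (2 * n + 1 - j) else j)"

lemma reverse_middle_involution: "reverse_middle n (reverse_middle n x) = x"
  by (auto simp: reverse_middle_def)

lemma reverse_middle_in_hyperoctahedral: "reverse_middle n \<in> hyperoctahedral n"
proof -
  have "bij_betw (reverse_middle n) {1..2 * n} {1..2 * n}"
    by (rule bij_betw_byWitness[where f' = "reverse_middle n"])
      (auto simp: reverse_middle_involution, auto simp: reverse_middle_def)
  then have "reverse_middle n permutes {1..2 * n}"
    by (rule bij_imp_permutes) (auto simp: reverse_middle_def)
  then show ?thesis
    unfolding hyperoctahedral_def reverse_middle_def by auto
qed

lemma half_extremal_cases:
  assumes "1 \<le> j" "j \<le> n"
  obtains (low) d where "j + 2 * d = n" "half_extremal n j = 1 + d" "1 + d + n div 2 \<le> n"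
  | (middle) d where "j + 2 * d + 1 = n" "half_extremal n j = n + 1 + d" "d < n div 2"
proof (cases "even (n - j)")
  case True
  then obtain d where "n - j = 2 * d" by blast
  then show thesis using assms by (intro low[of d]) (auto simp: half_extremal_def)
next
  case False
  then obtain d where "n - j = 2 * d + 1" using oddE by blast
  then show thesis using assms by (intro middle[of d]) (auto simp: half_extremal_def)
qed

lemma half_extremal_range:
  assumes "1 \<le> j" "j \<le> n"
  shows "1 \<le> half_extremal n j \<and> half_extremal n j \<le> 2 * n"
  using assms by (cases rule: half_extremal_cases) auto

lemma extremal_mirror:
  assumes "1 \<le> j" "j \<le> 2 * n"
  shows "extremal n (2 * n + 1 - j) = 2 * n + 1 - extremal n j"
proof (cases "j \<le> n")
  case True
  then show ?thesis using assms by (auto simp: extremal_def)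
next
  case False
  have "half_extremal n (2 * n + 1 - j) \<le> 2 * n"
    using half_extremal_range[of "2 * n + 1 - j" n] False assms by auto
  then show ?thesis using assms False by (auto simp: extremal_def)
qed

lemma extremal_in_hyperoctahedral: "extremal n \<in> hyperoctahedral n"
proof -
  note half = half_extremal_range
  have range: "extremal n j \<in> {1..2 * n}" if "j \<in> {1..2 * n}" for j
  proof (cases "j \<le> n")
    case False
    then have "1 \<le> 2 * n + 1 - j" "2 * n + 1 - j \<le> n" using that by auto
    then have "1 \<le> 2 * n + 1 - half_extremal n (2 * n + 1 - j) \<and>
        2 * n + 1 - half_extremal n (2 * n + 1 - j) \<le> 2 * n"
      using half[of "2 * n + 1 - j" n] by linarith
    then show ?thesis using that False by (simp add: extremal_def)
  qed (use that half[of j n] in \<open>auto simp: extremal_def\<close>)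
  have eq: "i = j" if "1 \<le> i" "i \<le> n" "1 \<le> j" "j \<le> n" "half_extremal n i = half_extremal n j" for i j
    using that(1,2)
  proof (cases rule: half_extremal_cases)
    case (low d)
    from that(3,4) show ?thesis by (cases rule: half_extremal_cases) (use low that(5) in auto)
  next
    case (middle d)
    from that(3,4) show ?thesis by (cases rule: half_extremal_cases) (use middle that(5) in auto)
  qed
  \<comment> \<open>Values on the left are at most n - n div 2 or in n + 1, ..., n + n div 2; their
    mirrors exceed n + n div 2 or lie in n - n div 2 + 1, ..., n.\<close>
  have ne: "half_extremal n i \<noteq> 2 * n + 1 - half_extremal n j" if "1 \<le> i" "i \<le> n" "1 \<le> j" "j \<le> n" for i j
    using that(1,2)
  proof (cases rule: half_extremal_cases)
    case (low d)
    from that(3,4) show ?thesis by (cases rule: half_extremal_cases) (use low in linarith)+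
  next
    case (middle d)
    from that(3,4) show ?thesis by (cases rule: half_extremal_cases) (use middle in linarith)+
  qed
  have inj: "inj_on (extremal n) {1..2 * n}"
  proof (rule inj_onI)
    fix i j assume ij: "i \<in> {1..2 * n}" "j \<in> {1..2 * n}" "extremal n i = extremal n j"
    let ?i = "2 * n + 1 - i" and ?j = "2 * n + 1 - j"
    consider "i \<le> n" "j \<le> n" | "i \<le> n" "n < j" | "n < i" "j \<le> n" | "n < i" "n < j" by linarith
    then show "i = j"
    proof cases
      case 1
      then show ?thesis using ij eq[of i j] by (simp add: extremal_def)
    next
      case 2
      then have "1 \<le> ?j" "?j \<le> n" using ij by auto
      then show ?thesis using 2 ij ne[of i ?j] by (auto simp: extremal_def)
    next
      case 3
      then have "1 \<le> ?i" "?i \<le> n" using ij by auto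
      then show ?thesis using 3 ij ne[of j ?i] by (auto simp: extremal_def)
    next
      case 4
      then have r: "1 \<le> ?i" "?i \<le> n" "1 \<le> ?j" "?j \<le> n" using ij by auto
      have "2 * n + 1 - half_extremal n ?i = 2 * n + 1 - half_extremal n ?j"
        using 4 ij by (simp add: extremal_def)
      then have "half_extremal n ?i = half_extremal n ?j"
        using half[OF r(1,2)] half[OF r(3,4)] by linarith
      then have "?i = ?j" using eq r by blast
      then show ?thesis using ij by auto
    qed
  qed
  have "bij_betw (extremal n) {1..2 * n} {1..2 * n}"
    using inj range by (simp add: bij_betw_def endo_inj_surj image_subset_iff)
  then have "extremal n permutes {1..2 * n}"
    by (rule bij_imp_permutes) (auto simp: extremal_def)
  then show ?thesis using extremal_mirror by (simp add: hyperoctahedral_def)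
qed

text \<open>In \<open>low\<close> and \<open>high\<close> the value lies outside the reversed
  window, in \<open>left\<close> and \<open>right\<close> inside it. The equations are additive so
  that linear arithmetic can use them.\<close>

lemma extremal_cases:
  assumes "1 \<le> j" "j \<le> 2 * n"
  obtains (low) d where "j + 2 * d = n" "extremal n j = 1 + d"
      "reverse_middle n (extremal n j) = 1 + d" "1 + d + n div 2 \<le> n"
  | (left) d where "j + 2 * d + 1 = n" "extremal n j = n + 1 + d"
      "reverse_middle n (extremal n j) + d = n" "d < n div 2"
  | (right) d where "j = n + 2 + 2 * d" "extremal n j + d = n"
      "reverse_middle n (extremal n j) = n + 1 + d" "d < n div 2"
  | (high) d where "j = n + 1 + 2 * d" "extremal n j + d = 2 * n"
      "reverse_middle n (extremal n j) + d = 2 * n" "1 + d + n div 2 \<le> n"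
proof (cases "j \<le> n")
  case True
  then have e: "extremal n j = half_extremal n j" using assms by (simp add: extremal_def)
  from assms(1) True show thesis
  proof (cases rule: half_extremal_cases)
    case (low d)
    then show thesis using e by (intro that(1)[of d]) (auto simp: reverse_middle_def)
  next
    case (middle d)
    then show thesis using e by (intro that(2)[of d]) (auto simp: reverse_middle_def)
  qed
next
  case False
  then have e: "extremal n j = 2 * n + 1 - half_extremal n (2 * n + 1 - j)"
    using assms by (simp add: extremal_def)
  have "1 \<le> 2 * n + 1 - j" "2 * n + 1 - j \<le> n" using False assms by auto
  then show thesis
  proof (cases rule: half_extremal_cases)
    case (low d)
    then have "extremal n j + d = 2 * n" "j = n + 1 + 2 * d" using e False assms by auto
    then show thesis using low(3) by (intro that(4)[of d]) (auto simp: reverse_middle_def)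
  next
    case (middle d)
    then have "extremal n j + d = n" "j = n + 2 + 2 * d" using e False assms by auto
    then show thesis using middle(3) by (intro that(3)[of d]) (auto simp: reverse_middle_def)
  qed
qed

lemma extremal_low:
  assumes "1 \<le> j" "j + 2 * d = n"
  shows "extremal n j = 1 + d"
proof -
  have "n - j = 2 * d" using assms by simp
  then show ?thesis using assms by (simp add: extremal_def half_extremal_def)
qed

lemma extremal_high:
  assumes "j \<le> 2 * n" "j = n + 1 + 2 * d"
  shows "extremal n j + d = 2 * n"
proof -
  have "n - (2 * n + 1 - j) = 2 * d" using assms by simp
  moreover have "d < n" using assms by simp
  ultimately show ?thesis using assms by (simp add: extremal_def half_extremal_def)
qed

text \<open>A middle column i <= n has a low column just to its right, whose upward wall separates
  it from everything middle beyond. If i > n, the high column just left of j does the same with its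
  downward wall.\<close>

lemma middle_incomparable:
  assumes ij: "1 \<le> i" "i < j" "j \<le> 2 * n"
    and mid: "n - n div 2 < extremal n i" "extremal n i \<le> n + n div 2"
      "n - n div 2 < extremal n j" "extremal n j \<le> n + n div 2"
  shows "(i, j) \<notin> permutree_order n (extremal n)" "(j, i) \<notin> permutree_order n (extremal n)"
proof -
  let ?w = "extremal n"
  have "(\<exists>k. i < k \<and> k < j \<and> k \<le> n \<and> ?w k < ?w i \<and> ?w k < ?w j) \<or>
    (\<exists>l. i < l \<and> l < j \<and> n < l \<and> ?w i < ?w l \<and> ?w j < ?w l)"
  proof (cases "i \<le> n")
    case True
    have "i \<le> 2 * n" using ij by simp
    with ij(1) obtain d where d: "i + 2 * d + 1 = n" "d < n div 2"
      by (cases rule: extremal_cases) (use mid True in auto)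
    have wk: "?w (i + 1) = 1 + d" using extremal_low[of "i + 1" d n] d by simp
    then have "?w (i + 1) \<le> n - n div 2" using d by linarith
    moreover have "i + 1 \<noteq> j" using calculation mid by auto
    ultimately have "i < i + 1 \<and> i + 1 < j \<and> i + 1 \<le> n \<and> ?w (i + 1) < ?w i \<and> ?w (i + 1) < ?w j"
      using mid d ij by linarith
    then show ?thesis by blast
  next
    case False
    have "1 \<le> j" using ij by simp
    from this ij(3) obtain d where d: "j = n + 2 + 2 * d" "d < n div 2"
      by (cases rule: extremal_cases) (use mid False ij in auto)
    have wk: "?w (j - 1) + d = 2 * n" using extremal_high[of "j - 1" n d] d ij by simp
    then have "n + n div 2 < ?w (j - 1)" using d by linarith
    moreover have "i \<noteq> j - 1" using calculation mid by auto
    ultimately have "i < j - 1 \<and> j - 1 < j \<and> n < j - 1 \<and> ?w i < ?w (j - 1) \<and> ?w j < ?w (j - 1)"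
      using mid d ij False by linarith
    then show ?thesis by blast
  qed
  then show "(i, j) \<notin> permutree_order n ?w" "(j, i) \<notin> permutree_order n ?w"
    unfolding permutree_order_increasing_iff[OF extremal_in_hyperoctahedral ij]
      permutree_order_decreasing_iff[OF extremal_in_hyperoctahedral ij]
    by (meson order.asym)+
qed

lemma reverse_middle_less:
  assumes "x < y" "\<not> (n - n div 2 < x \<and> x \<le> n + n div 2 \<and> n - n div 2 < y \<and> y \<le> n + n div 2)"
  shows "reverse_middle n x < reverse_middle n y"
  using assms unfolding reverse_middle_def by (simp; linarith)

text \<open>The reversed values sit in pairwise incomparable columns, so the result is still a
  linear extension. Its middle values increase from left to right, and the order forces the
  remaining inversions.\<close>

lemma pi_down_extremal: "pi_down n (extremal n) = reverse_middle n \<circ> extremal n"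
proof (rule pi_down_eqI)
  let ?w = "extremal n" and ?v = "reverse_middle n \<circ> extremal n"
  note w = extremal_in_hyperoctahedral[of n]
  have v: "?v \<in> hyperoctahedral n"
    by (rule comp_in_hyperoctahedral[OF reverse_middle_in_hyperoctahedral w])
  have "?v i < ?v j" if ij: "(i, j) \<in> permutree_order n ?w" "i \<noteq> j" for i j
  proof -
    have r: "1 \<le> i" "i \<le> 2 * n" "1 \<le> j" "j \<le> 2 * n" using permutree_order_range[OF ij(1)] by auto
    have "\<not> (n - n div 2 < ?w i \<and> ?w i \<le> n + n div 2 \<and> n - n div 2 < ?w j \<and> ?w j \<le> n + n div 2)"
      using middle_incomparable[of i j n] middle_incomparable[of j i n] r ij by (cases "i < j") auto
    then show ?thesis using reverse_middle_less permutree_order_less[OF ij] by simp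
  qed
  then show "?v \<in> sylvester_class n ?w"
    using permutree_order_linear_extension[OF w v] v by (simp add: sylvester_class_def)
  fix i j assume ij: "1 \<le> i" "i < j" "j \<le> 2 * n" "?v j < ?v i"
  have r: "i \<le> 2 * n" "1 \<le> j" using ij by auto
  \<comment> \<open>An inversion of the reversed permutation ends in a low column or starts in a
    high one.\<close>
  have "(\<exists>d. j + 2 * d = n \<and> ?w j = 1 + d) \<or> (\<exists>d. i = n + 1 + 2 * d \<and> ?w i + d = 2 * n)"
    using ij(1) r(1)
    by (cases rule: extremal_cases; use r(2) ij(3) in \<open>cases rule: extremal_cases\<close>)
      (use ij in auto)
  then show "(j, i) \<in> permutree_order n ?w"
    unfolding permutree_order_decreasing_iff[OF w ij(1-3)]
  proof (elim disjE exE conjE)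
    \<comment> \<open>The low column j has the least value among the columns from i to j, and j <= n
      makes the clauses about downward walls vacuous.\<close>
    fix d assume d: "j + 2 * d = n" "?w j = 1 + d"
    have "?w j < ?w k" if "i \<le> k" "k < j" for k
    proof -
      have "1 \<le> k" "k \<le> 2 * n" using that ij by auto
      then show ?thesis by (cases rule: extremal_cases) (use d that in auto)
    qed
    then show "?w j < ?w i \<and> (\<forall>k. i < k \<and> k < j \<and> k \<le> n \<longrightarrow> ?w j < ?w k) \<and>
        (\<forall>l. i < l \<and> l < j \<and> n < l \<longrightarrow> ?w l < ?w i) \<and>
        (\<forall>k l. i < k \<and> k \<le> n \<and> n < l \<and> l < j \<longrightarrow> ?w l < ?w k)"
      using d ij by auto
  next
    fix d assume d: "i = n + 1 + 2 * d" "?w i + d = 2 * n"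
    have "?w l < ?w i" if "i < l" "l \<le> j" for l
    proof -
      have "1 \<le> l" "l \<le> 2 * n" using that ij by auto
      then show ?thesis by (cases rule: extremal_cases) (use d that in auto)
    qed
    then show "?w j < ?w i \<and> (\<forall>k. i < k \<and> k < j \<and> k \<le> n \<longrightarrow> ?w j < ?w k) \<and>
        (\<forall>l. i < l \<and> l < j \<and> n < l \<longrightarrow> ?w l < ?w i) \<and>
        (\<forall>k l. i < k \<and> k \<le> n \<and> n < l \<and> l < j \<longrightarrow> ?w l < ?w k)"
      using d ij by auto
  qed
qed

text \<open>With r = \<open>reverse_middle n\<close> and w = \<open>extremal n\<close>, the product
  of w and the inverse of r w is the inverse of r, which is r.\<close>

lemma stack_sort_extremal: "stack_sort n (extremal n) = reverse_middle n"
proof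
  fix x
  let ?v = "reverse_middle n \<circ> extremal n"
  note v = hyperoctahedralD[OF comp_in_hyperoctahedral[OF reverse_middle_in_hyperoctahedral
        extremal_in_hyperoctahedral]]
  have "extremal n (inv ?v x) = reverse_middle n (?v (inv ?v x))"
    by (simp add: reverse_middle_involution)
  also have "\<dots> = reverse_middle n x" using v(5) by simp
  finally show "stack_sort n (extremal n) x = reverse_middle n x"
    by (simp add: stack_sort_def pi_down_extremal)
qed

text \<open>Descent sets consist of generators; this allows counting them by index. For i < j the
  j-th generator fixes i, while the i-th moves it.\<close>

lemma simple_gen_inj: "inj_on (simple_gen n) {1..n}"
proof (rule linorder_inj_onI)
  fix i j assume ij: "i < j" "i \<in> {1..n}" "j \<in> {1..n}"
  have "simple_gen n i i = i + 1"
    using simple_gen_apply[of i n "2 * n - i" i] ij by simp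
  moreover have "simple_gen n j i = i"
    using simple_gen_apply[of j n "2 * n - j" i] ij by auto
  ultimately show "simple_gen n i \<noteq> simple_gen n j" by auto
qed auto

lemma card_right_descents_reverse_middle: "n div 2 \<le> card (right_descents n (reverse_middle n))"
proof -
  have "simple_gen n ` {n - n div 2<..n} \<subseteq> right_descents n (reverse_middle n)"
  proof
    fix s assume "s \<in> simple_gen n ` {n - n div 2<..n}"
    then obtain a where a: "s = simple_gen n a" "n - n div 2 < a" "a \<le> n" by auto
    then have "reverse_middle n (a + 1) < reverse_middle n a" by (auto simp: reverse_middle_def)
    then show "s \<in> right_descents n (reverse_middle n)" using a by (auto simp: right_descents_def)
  qed
  moreover have "right_descents n (reverse_middle n) \<subseteq> simple_gen n ` {1..n}"
    by (auto simp: right_descents_def)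
  then have "finite (right_descents n (reverse_middle n))" by (rule finite_subset) simp
  ultimately have "card (simple_gen n ` {n - n div 2<..n}) \<le> card (right_descents n (reverse_middle n))"
    by (rule card_mono[rotated])
  moreover have "card (simple_gen n ` {n - n div 2<..n}) = card {n - n div 2<..n}"
    by (rule card_image, rule inj_on_subset[OF simple_gen_inj]) auto
  ultimately show ?thesis by simp
qed

theorem theorem7p3:
  fixes n :: nat
  assumes "n \<ge> 1"
  shows "Max ((\<lambda>w. card (right_descents n (stack_sort n w))) ` hyperoctahedral n) = n div 2"
proof (rule Max_eqI)
  show "finite ((\<lambda>w. card (right_descents n (stack_sort n w))) ` hyperoctahedral n)"
    by (simp add: finite_hyperoctahedral)
  show "k \<le> n div 2"
    if "k \<in> (\<lambda>w. card (right_descents n (stack_sort n w))) ` hyperoctahedral n" for k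
    using that card_right_descents_stack_sort by auto
  have "card (right_descents n (stack_sort n (extremal n))) = n div 2"
    using card_right_descents_stack_sort[OF extremal_in_hyperoctahedral, of n]
      card_right_descents_reverse_middle[of n]
    by (simp add: stack_sort_extremal)
  then show "n div 2 \<in> (\<lambda>w. card (right_descents n (stack_sort n w))) ` hyperoctahedral n"
    using extremal_in_hyperoctahedral by (metis image_eqI)
qed

end
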